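(* For every integer $k\geq 0$, the simplicial join $$\underbrace{\Delta_{12,33}*\cdots*\Delta_{12,33}}_{k+1\text{ copies}}$$ of $k+1$ (vertex-disjoint) copies of the complex $\Delta_{12,33}$ (defined in the context) is a flag simplicial $(4k+3)$-sphere such that: it has no contractible edge and it is not a suspension; and all of its induced equators are links of a vertex.
   Context: Simplicial complexes are finite abstract simplicial complexes; faces are written as strings of vertices (e.g. $x_1x_2y_3=\{x_1,x_2,y_3\}$), and $\langle F_1,\dots,F_k\rangle$ is the complex whose facets (inclusion-maximal faces) are $F_1,\dots,F_k$. The join of complexes on disjoint vertex sets is $\Delta*\Gamma=\{F\cup G: F\in\Delta, G\in\Gamma\}$, and $\{v\}*\Delta:=\Delta*\langle\{v\}\rangle$ is the cone. A complex is a suspension if it equals $\Delta*\langle\{v\},\{w\}\rangle$ for some simplicial complex $\Delta$ and two distinct vertices $v,w$ not in $\Delta$. For a subset $W$ of the vertex set, the induced subcomplex is $\Delta[W]=\{F\in\Delta: F\subseteq W\}$. The link of a face $F$ is $\mathrm{lk}_\Delta(F)=\{G\in\Delta: F\cup G\in\Delta,\ F\cap G=\emptyset\}$; the link of a vertex $v$ is $\mathrm{lk}_\Delta(\{v\})$. A complex is a simplicial $d$-sphere if its geometric realization is homeomorphic to $\mathbb{S}^d$. A complex is flag if every inclusion-minimal non-face (subset of the vertex set that is not a face) has cardinality $2$. An edge of $\Delta$ is contractible if it is not contained in any induced subcomplex of $\Delta$ isomorphic to a $4$-cycle. An induced equator of a simplicial $d$-sphere is an induced subcomplex that is a simplicial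 $(d-1)$-sphere. For distinct elements $p_1,p_2,p_3,q_1,q_2,q_3$ put $$\Diamond([p_1,p_2,p_3],[q_1,q_2,q_3])=\langle\{p_1\},\{q_1\}\rangle*\langle\{p_2\},\{q_2\}\rangle*\langle\{p_3\},\{q_3\}\rangle.$$ Definition of $\Delta_{12,33}$: the vertex set is $\{x_1,x_2,x_3,y_1,y_2,y_3,z_1,z_2,z_3,v_1,v_2,v_3\}$ ($12$ distinct elements) and $\Delta_{12,33}=\Gamma_1\cup\Gamma_2$, where $$\Gamma_1=\{v_1\}*\Diamond([x_1,x_2,x_3],[y_1,y_2,y_3])\ \cup\ \{v_2\}*\Diamond([y_1,y_2,y_3],[z_1,z_2,z_3])\ \cup\ \{v_3\}*\Diamond([x_1,x_2,x_3],[z_3,z_1,z_2])$$ and $$\Gamma_2=\langle x_1x_2y_3z_2,\ x_2y_1y_3z_2,\ x_2y_1z_2z_3,\ x_2x_3y_1z_3,\ x_3y_1y_2z_3,\ x_3y_2z_1z_3,\ x_1x_3y_2z_1,\ x_1y_2y_3z_1,\ x_1y_3z_1z_2\rangle.$$ *)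

theory Defs
  imports "HOL-Homology.Homology"
begin

definition simplicial_complex :: "'a set set \<Rightarrow> bool" where
  "simplicial_complex K \<longleftrightarrow>
     finite K \<and> {} \<in> K \<and> (\<forall>F\<in>K. finite F) \<and> (\<forall>F\<in>K. \<forall>G. G \<subseteq> F \<longrightarrow> G \<in> K)"

definition vertices :: "'a set set \<Rightarrow> 'a set" where
  "vertices K = \<Union> K"

definition complex_of_facets :: "'a set set \<Rightarrow> 'a set set" where
  "complex_of_facets S = {F. \<exists>G\<in>S. F \<subseteq> G}"

definition simplicial_join :: "'a set set \<Rightarrow> 'a set set \<Rightarrow> 'a set set" where
  "simplicial_join K L = {F \<union> G | F G. F \<in> K \<and> G \<in> L}"

definition cone :: "'a \<Rightarrow> 'a set set \<Rightarrow> 'a set set" where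
  "cone v K = simplicial_join K (complex_of_facets {{v}})"

definition is_suspension :: "'a set set \<Rightarrow> bool" where
  "is_suspension K \<longleftrightarrow>
     (\<exists>L v w. simplicial_complex L \<and> v \<noteq> w \<and> v \<notin> vertices L \<and> w \<notin> vertices L \<and>
        K = simplicial_join L (complex_of_facets {{v}, {w}}))"

definition induced_subcomplex :: "'a set set \<Rightarrow> 'a set \<Rightarrow> 'a set set" where
  "induced_subcomplex K W = {F \<in> K. F \<subseteq> W}"

definition face_link :: "'a set set \<Rightarrow> 'a set \<Rightarrow> 'a set set" where
  "face_link K F = {G \<in> K. F \<union> G \<in> K \<and> F \<inter> G = {}}"

text \<open>Points of the realization are given by barycentric coordinates, extended by 0 to the
  whole vertex type; for finite complexes the product topology induces the usual topology.\<close>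

definition geometric_realization :: "'a set set \<Rightarrow> ('a \<Rightarrow> real) topology" where
  "geometric_realization K = subtopology (powertop_real UNIV)
     {t. (\<forall>v. 0 \<le> t v) \<and> {v. t v \<noteq> 0} \<in> K \<and> (\<Sum>v\<in>vertices K. t v) = 1}"

definition simplicial_sphere :: "nat \<Rightarrow> 'a set set \<Rightarrow> bool" where
  "simplicial_sphere d K \<longleftrightarrow>
     simplicial_complex K \<and> geometric_realization K homeomorphic_space nsphere d"

definition minimal_nonface :: "'a set set \<Rightarrow> 'a set \<Rightarrow> bool" where
  "minimal_nonface K F \<longleftrightarrow> F \<subseteq> vertices K \<and> F \<notin> K \<and> (\<forall>G. G \<subset> F \<longrightarrow> G \<in> K)"

definition flag :: "'a set set \<Rightarrow> bool" where
  "flag K \<longleftrightarrow> (\<forall>F. minimal_nonface K F \<longrightarrow> card F = 2)"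

definition isomorphic_complexes :: "'a set set \<Rightarrow> 'b set set \<Rightarrow> bool" where
  "isomorphic_complexes K L \<longleftrightarrow>
     (\<exists>f. bij_betw f (vertices K) (vertices L) \<and> (\<lambda>F. f ` F) ` K = L)"

definition four_cycle :: "nat set set" where
  "four_cycle = complex_of_facets {{0, 1}, {1, 2}, {2, 3}, {3, 0}}"

definition contractible_edge :: "'a set set \<Rightarrow> 'a set \<Rightarrow> bool" where
  "contractible_edge K e \<longleftrightarrow> e \<in> K \<and> card e = 2 \<and>
     \<not> (\<exists>W \<subseteq> vertices K. isomorphic_complexes (induced_subcomplex K W) four_cycle \<and>
          e \<in> induced_subcomplex K W)"

text \<open>The only simplicial (-1)-sphere is the complex whose sole face is the empty one.\<close>

definition induced_equator :: "nat \<Rightarrow> 'a set set \<Rightarrow> 'a set set \<Rightarrow> bool" where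
  "induced_equator d K E \<longleftrightarrow> simplicial_sphere d K \<and>
     (\<exists>W \<subseteq> vertices K. E = induced_subcomplex K W) \<and>
     (case d of 0 \<Rightarrow> E = {{}} | Suc m \<Rightarrow> simplicial_sphere m E)"

fun diamond :: "'a \<times> 'a \<times> 'a \<Rightarrow> 'a \<times> 'a \<times> 'a \<Rightarrow> 'a set set" where
  "diamond (p1, p2, p3) (q1, q2, q3) =
     simplicial_join
       (simplicial_join (complex_of_facets {{p1}, {q1}}) (complex_of_facets {{p2}, {q2}}))
       (complex_of_facets {{p3}, {q3}})"

datatype vertex12 = X1 | X2 | X3 | Y1 | Y2 | Y3 | Z1 | Z2 | Z3 | V1 | V2 | V3

definition Gamma1 :: "vertex12 set set" where
  "Gamma1 = cone V1 (diamond (X1, X2, X3) (Y1, Y2, Y3)) \<union>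
            cone V2 (diamond (Y1, Y2, Y3) (Z1, Z2, Z3)) \<union>
            cone V3 (diamond (X1, X2, X3) (Z3, Z1, Z2))"

definition Gamma2 :: "vertex12 set set" where
  "Gamma2 = complex_of_facets
     {{X1, X2, Y3, Z2}, {X2, Y1, Y3, Z2}, {X2, Y1, Z2, Z3},
      {X2, X3, Y1, Z3}, {X3, Y1, Y2, Z3}, {X3, Y2, Z1, Z3},
      {X1, X3, Y2, Z1}, {X1, Y2, Y3, Z1}, {X1, Y3, Z1, Z2}}"

definition Delta_12_33 :: "vertex12 set set" where
  "Delta_12_33 = Gamma1 \<union> Gamma2"

definition labelled_copy :: "nat \<Rightarrow> 'a set set \<Rightarrow> (nat \<times> 'a) set set" where
  "labelled_copy i K = (\<lambda>F. Pair i ` F) ` K"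

text \<open>The join of the \<open>k + 1\<close> vertex-disjoint copies of \<open>K\<close> with labels \<open>0, \<dots>, k\<close>.\<close>

primrec iterated_join :: "nat \<Rightarrow> 'a set set \<Rightarrow> (nat \<times> 'a) set set" where
  "iterated_join 0 K = labelled_copy 0 K"
| "iterated_join (Suc k) K = simplicial_join (iterated_join k K) (labelled_copy (Suc k) K)"

end

theory Submission
  imports Defs
begin

text \<open>Every complex here is treated through a complete simplicial fan: a map of the vertices to
  \<open>\<real>\<^sup>n\<close> such that each point is a nonnegative combination of the vertices of a face in exactly one
  way. Radial projection then identifies the realization with the unit sphere, and fans of the
  factors of a join add up to a fan of the join. For \<open>\<Delta>\<^sub>1\<^sub>2\<^sub>,\<^sub>3\<^sub>3\<close> the fan is spanned by the boundary of
  an explicit convex 4-polytope: a point lies in the cone of the facet whose supporting functional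
  is largest at it.

  If an induced subcomplex \<open>E = D[W]\<close> is an equator, the cone over \<open>E\<close> is homeomorphic to a
  hyperplane of \<open>\<real>\<^sup>n\<close>. Homeomorphic closed sets in \<open>\<real>\<^sup>n\<close> have equally many complementary
  components, so the cone over \<open>E\<close> separates \<open>\<real>\<^sup>n\<close>, whereas the cone over \<open>E\<close> without an open star
  does not. Combinatorially, the vertices outside \<open>W\<close> split into nonempty parts \<open>U\<^sub>1\<close>, \<open>U\<^sub>2\<close> without
  edges in between, and each nonempty face of \<open>E\<close> extends to a face by a vertex of \<open>U\<^sub>1\<close>, and also
  by one of \<open>U\<^sub>2\<close>. In a join, vertices of different factors are adjacent, so \<open>U\<^sub>1\<close> and \<open>U\<^sub>2\<close> lie
  in a single copy of \<open>\<Delta>\<^sub>1\<^sub>2\<^sub>,\<^sub>3\<^sub>3\<close>. If one of them is a single vertex \<open>v\<close>, then \<open>E\<close> is the link of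
  \<open>v\<close>; otherwise some facet of the copy avoids \<open>U\<^sub>1\<close> and \<open>U\<^sub>2\<close>, and it cannot be extended.\<close>

subsection \<open>Cones over subsets of the unit sphere\<close>

text \<open>Padding with zeros makes \<open>Eucl n\<close> a hyperplane of
  \<open>Eucl (Suc n)\<close> and \<open>unit_sphere n\<close> a great sphere of
  \<open>unit_sphere (Suc n)\<close>; the separation arguments compare with this standard
  pair.\<close>

definition Eucl :: "nat \<Rightarrow> (nat \<Rightarrow> real) set" where
  "Eucl n = {x. \<forall>i\<ge>n. x i = 0}"

definition l2norm :: "nat \<Rightarrow> (nat \<Rightarrow> real) \<Rightarrow> real" where
  "l2norm n x = sqrt (\<Sum>i<n. (x i)\<^sup>2)"

definition unit_sphere :: "nat \<Rightarrow> (nat \<Rightarrow> real) set" where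
  "unit_sphere n = {x \<in> Eucl n. l2norm n x = 1}"

text \<open>The origin is inserted by hand so that the cone over the empty set is a point, as is the
  cone of the complex whose only face is empty.\<close>

definition cone_over :: "(nat \<Rightarrow> real) set \<Rightarrow> (nat \<Rightarrow> real) set" where
  "cone_over S = insert (\<lambda>_. 0) {\<lambda>i. r * x i | r x. 0 < r \<and> x \<in> S}"

text \<open>The positively homogeneous extension of a map between subsets of the sphere to their
  cones.\<close>

definition radial_ext :: "nat \<Rightarrow> ((nat \<Rightarrow> real) \<Rightarrow> nat \<Rightarrow> real) \<Rightarrow> (nat \<Rightarrow> real) \<Rightarrow> nat \<Rightarrow> real" where
  "radial_ext n f x = (if x = (\<lambda>_. 0) then (\<lambda>_. 0)
     else (\<lambda>i. l2norm n x * f (\<lambda>j. x j / l2norm n x) i))"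

lemma Euclidean_space_eq: "Euclidean_space n = top_of_set (Eucl n)"
  by (simp add: Euclidean_space_def Eucl_def euclidean_product_topology)

lemma nsphere_eq: "nsphere d = top_of_set (unit_sphere (Suc d))"
proof -
  have "Eucl (Suc d) \<inter> {x. (\<Sum>i\<le>d. (x i)\<^sup>2) = 1} = unit_sphere (Suc d)"
    by (auto simp: unit_sphere_def l2norm_def lessThan_Suc_atMost)
  then show ?thesis
    by (simp add: nsphere_def Euclidean_space_eq subtopology_subtopology)
qed

lemma continuous_on_coordinate [continuous_intros]:
  "continuous_on S (\<lambda>x :: 'i \<Rightarrow> 'b::topological_space. x i)"
  by (rule continuous_on_subset[OF continuous_on_product_coordinates]) simp

lemma continuous_on_l2norm [continuous_intros]: "continuous_on S (l2norm n)"
  unfolding l2norm_def[abs_def] by (intro continuous_intros)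

lemma l2norm_nonneg: "0 \<le> l2norm n x"
  by (simp add: l2norm_def sum_nonneg)

lemma l2norm_scale: "l2norm n (\<lambda>i. r * x i) = \<bar>r\<bar> * l2norm n x"
  by (simp add: l2norm_def power_mult_distrib real_sqrt_mult flip: sum_distrib_left)

lemma l2norm_eq_0_iff: "x \<in> Eucl n \<Longrightarrow> l2norm n x = 0 \<longleftrightarrow> x = (\<lambda>_. 0)"
  by (auto simp: l2norm_def Eucl_def sum_nonneg_eq_0_iff fun_eq_iff) (meson leI lessThan_iff)

lemma coord_le_l2norm: "x \<in> Eucl n \<Longrightarrow> \<bar>x i\<bar> \<le> l2norm n x"
proof (cases "i < n")
  case True
  then have "(x i)\<^sup>2 \<le> (\<Sum>i<n. (x i)\<^sup>2)"
    by (intro member_le_sum) auto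
  then show ?thesis
    by (simp add: l2norm_def real_le_rsqrt)
next
  case False
  then show "x \<in> Eucl n \<Longrightarrow> ?thesis" by (simp add: Eucl_def l2norm_nonneg)
qed

lemma unit_sphere_nonzero: "x \<in> unit_sphere n \<Longrightarrow> x \<noteq> (\<lambda>_. 0)"
  by (auto simp: unit_sphere_def l2norm_def)

lemma unit_sphere_mono:
  assumes "m \<le> n" shows "unit_sphere m \<subseteq> unit_sphere n"
proof
  fix x assume x: "x \<in> unit_sphere m"
  have "(\<Sum>i<n. (x i)\<^sup>2) = (\<Sum>i<m. (x i)\<^sup>2)"
    using x assms by (intro sum.mono_neutral_right) (auto simp: unit_sphere_def Eucl_def)
  then show "x \<in> unit_sphere n"
    using x assms by (auto simp: unit_sphere_def Eucl_def l2norm_def)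
qed

lemma cone_over_cases:
  assumes "x \<in> cone_over S"
  obtains "x = (\<lambda>_. 0)" | r s where "0 < r" "s \<in> S" "x = (\<lambda>i. r * s i)"
  using assms by (auto simp: cone_over_def)

lemma cone_over_scale: "s \<in> S \<Longrightarrow> 0 < r \<Longrightarrow> (\<lambda>i. r * s i) \<in> cone_over S"
  by (auto simp: cone_over_def)

lemma cone_over_mono: "S \<subseteq> T \<Longrightarrow> cone_over S \<subseteq> cone_over T"
  by (auto simp: cone_over_def)

lemma zero_in_cone_over: "(\<lambda>_. 0) \<in> cone_over S"
  by (simp add: cone_over_def)

lemma normalize_in_unit_sphere:
  assumes "x \<in> Eucl n" "x \<noteq> (\<lambda>_. 0)"
  shows "(\<lambda>i. x i / l2norm n x) \<in> unit_sphere n"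
proof -
  have "l2norm n x \<noteq> 0" using assms by (simp add: l2norm_eq_0_iff)
  then have "l2norm n (\<lambda>i. inverse (l2norm n x) * x i) = 1"
    using l2norm_nonneg[of n x] by (simp add: l2norm_scale)
  then show ?thesis
    using assms(1) by (simp add: unit_sphere_def Eucl_def divide_inverse mult.commute)
qed

lemma cone_over_unit_sphere: "cone_over (unit_sphere n) = Eucl n"
proof
  show "cone_over (unit_sphere n) \<subseteq> Eucl n"
    by (auto simp: cone_over_def unit_sphere_def Eucl_def)
  show "Eucl n \<subseteq> cone_over (unit_sphere n)"
  proof
    fix x assume x: "x \<in> Eucl n"
    show "x \<in> cone_over (unit_sphere n)"
    proof (cases "x = (\<lambda>_. 0)")
      case False
      have "0 < l2norm n x"
        using x False l2norm_nonneg[of n x] l2norm_eq_0_iff[of x n] by linarith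
      then show ?thesis
        using cone_over_scale[OF normalize_in_unit_sphere[OF x False], of "l2norm n x"] by simp
    qed (simp add: zero_in_cone_over)
  qed
qed

lemma cone_over_subset_Eucl: "S \<subseteq> unit_sphere n \<Longrightarrow> cone_over S \<subseteq> Eucl n"
  using cone_over_mono cone_over_unit_sphere by metis

text \<open>A comparison of norms forces the two scale factors to agree, so the cone over
  \<open>S\<close> meets the unit sphere in \<open>S\<close> only.\<close>

lemma scaled_in_cone_over:
  assumes "S \<subseteq> unit_sphere n" "s \<in> unit_sphere n" "0 < r" "(\<lambda>i. r * s i) \<in> cone_over S"
  shows "s \<in> S"
  using assms(4)
proof (cases rule: cone_over_cases)
  case 1
  then show ?thesis
    using assms(2,3) unit_sphere_nonzero[of s n] by (auto simp: fun_eq_iff)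
next
  case (2 r' s')
  have "l2norm n (\<lambda>i. r * s i) = l2norm n (\<lambda>i. r' * s' i)" using 2 by simp
  moreover have "l2norm n s = 1" "l2norm n s' = 1"
    using assms(1,2) 2 by (auto simp: unit_sphere_def)
  ultimately have "r = r'" using assms(3) 2(1) unfolding l2norm_scale by simp
  moreover have "r * s i = r' * s' i" for i using 2(3) by meson
  ultimately have "s = s'" using assms(3) by (auto simp: fun_eq_iff)
  then show ?thesis using 2(2) by simp
qed

lemma radial_ext_zero [simp]: "radial_ext n f (\<lambda>_. 0) = (\<lambda>_. 0)"
  by (simp add: radial_ext_def)

lemma radial_ext_scale:
  assumes "s \<in> unit_sphere n" "0 < r"
  shows "radial_ext n f (\<lambda>i. r * s i) = (\<lambda>i. r * f s i)"
proof -
  have "l2norm n (\<lambda>i. r * s i) = r" using assms by (simp add: l2norm_scale unit_sphere_def)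
  moreover have "(\<lambda>i. r * s i) \<noteq> (\<lambda>_. 0)"
    using assms unit_sphere_nonzero[of s n] by (auto simp: fun_eq_iff)
  ultimately show ?thesis using assms by (simp add: radial_ext_def)
qed

text \<open>Off the origin the map is composed of continuous ones. At the origin the normalization
  breaks down, but every coordinate is bounded by \<open>l2norm n x\<close>, which tends to
  0.\<close>

lemma continuous_on_radial_ext:
  assumes S: "S \<subseteq> unit_sphere n" and f: "continuous_on S f" and fS: "f ` S \<subseteq> unit_sphere n"
  shows "continuous_on (cone_over S) (radial_ext n f)"
proof (rule continuous_on_coordinatewise_then_product)
  fix i
  let ?C = "cone_over S" and ?h = "\<lambda>x. radial_ext n f x i"
  have CE: "?C \<subseteq> Eucl n" using S by (rule cone_over_subset_Eucl)
  have bound: "norm (?h x) \<le> l2norm n x" if "x \<in> ?C" for x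
    using that
  proof (cases rule: cone_over_cases)
    case (2 r s)
    then have "\<bar>f s i\<bar> \<le> 1"
      using fS coord_le_l2norm[of "f s" n i] by (force simp: unit_sphere_def)
    then show ?thesis
      using 2 S radial_ext_scale[of s n r f]
      by (auto simp: abs_mult l2norm_scale unit_sphere_def subset_iff mult_left_le)
  qed (simp add: l2norm_nonneg)
  have "continuous (at x within ?C) ?h" if x: "x \<in> ?C" for x
  proof (cases "x = (\<lambda>_. 0)")
    case True
    have "(l2norm n \<longlongrightarrow> l2norm n x) (at x within ?C)"
      using continuous_on_l2norm[of ?C n] x by (auto simp: continuous_on_def)
    then have "(l2norm n \<longlongrightarrow> 0) (at x within ?C)" by (simp add: True l2norm_def)
    moreover have "\<forall>\<^sub>F y in at x within ?C. norm (?h y) \<le> l2norm n y"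
      using bound by (simp add: eventually_at_topological) blast
    ultimately have "(?h \<longlongrightarrow> 0) (at x within ?C)"
      by (rule Lim_null_comparison[rotated])
    then show ?thesis by (simp add: continuous_within True)
  next
    case False
    let ?D = "?C - {\<lambda>_. 0}"
    let ?g = "\<lambda>x. l2norm n x * f (\<lambda>j. x j / l2norm n x) i"
    have nz: "l2norm n y \<noteq> 0" if "y \<in> ?D" for y using that CE l2norm_eq_0_iff by blast
    have norm_in: "(\<lambda>j. y j / l2norm n y) \<in> S" if "y \<in> ?D" for y
    proof -
      have y: "y \<in> ?C" using that by blast
      then show ?thesis
      proof (cases rule: cone_over_cases)
        case (2 r s)
        then show ?thesis using S by (auto simp: l2norm_scale unit_sphere_def subset_iff)
      qed (use that in blast)
    qed
    have "continuous_on ?D (\<lambda>y j. y j / l2norm n y)"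
      using nz by (intro continuous_on_coordinatewise_then_product continuous_intros) auto
    then have "continuous_on ?D (\<lambda>y. f (\<lambda>j. y j / l2norm n y))"
      using f norm_in by (intro continuous_on_compose2[OF f]) auto
    then have "continuous_on ?D (\<lambda>y. f (\<lambda>j. y j / l2norm n y) i)"
      by (rule continuous_on_product_then_coordinatewise)
    then have "continuous_on ?D ?g" by (intro continuous_intros)
    then have "continuous_on ?D ?h"
      by (rule continuous_on_eq) (simp add: radial_ext_def)
    then have "continuous (at x within ?D) ?h"
      using x False continuous_on_eq_continuous_within by blast
    \<comment> \<open>Continuity at a nonzero point is local, so removing the origin from the domain
      does not affect it.\<close>
    moreover have "at x within ?D = at x within ?C"
      using False by (intro at_within_nhd[of x "- {\<lambda>_. 0}"]) auto
    ultimately show ?thesis by simp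
  qed
  then show "continuous_on ?C ?h" using continuous_on_eq_continuous_within by blast
qed

lemma homeomorphic_cone_over:
  assumes S: "S \<subseteq> unit_sphere n" and T: "T \<subseteq> unit_sphere n" and "S homeomorphic T"
  shows "cone_over S homeomorphic cone_over T"
proof -
  obtain f g where fg: "homeomorphism S T f g"
    using assms(3) by (auto simp: homeomorphic_def)
  \<comment> \<open>Stated for arbitrary data because it is applied both to \<open>f\<close> and to
    its inverse \<open>g\<close>: their radial extensions are mutually inverse.\<close>
  have img: "radial_ext n f ` cone_over S \<subseteq> cone_over T \<and>
      (\<forall>x\<in>cone_over S. radial_ext n g (radial_ext n f x) = x)"
    if "S \<subseteq> unit_sphere n" "T \<subseteq> unit_sphere n" "homeomorphism S T f g" for S T f g
  proof (intro conjI subsetI ballI)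
    fix y assume "y \<in> radial_ext n f ` cone_over S"
    then obtain x where x: "x \<in> cone_over S" "y = radial_ext n f x" by blast
    show "y \<in> cone_over T"
      using x(1)
    proof (cases rule: cone_over_cases)
      case (2 r s)
      then show ?thesis
        using x that by (auto simp: radial_ext_scale homeomorphism_def subset_iff intro!: cone_over_scale)
    qed (simp add: x zero_in_cone_over)
  next
    fix x assume "x \<in> cone_over S"
    then show "radial_ext n g (radial_ext n f x) = x"
    proof (cases rule: cone_over_cases)
      case (2 r s)
      moreover have "s \<in> unit_sphere n" "f s \<in> unit_sphere n" "g (f s) = s"
        using 2 that by (auto simp: homeomorphism_def)
      ultimately show ?thesis by (simp add: radial_ext_scale)
    qed simp
  qed
  note gf = homeomorphism_symD[OF fg]
  have "homeomorphism (cone_over S) (cone_over T) (radial_ext n f) (radial_ext n g)"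
    using img[OF S T fg] img[OF T S gf] fg S T
    by (intro homeomorphismI continuous_on_radial_ext) (auto simp: homeomorphism_def)
  then show ?thesis by (auto simp: homeomorphic_def)
qed

text \<open>Normalization is continuous on the open set of nonzero points, and the complement of the
  cone is the preimage under it of the complement of \<open>S\<close>.\<close>

lemma closed_cone_over:
  assumes S: "S \<subseteq> unit_sphere n" and cl: "compact S"
  shows "closedin (Euclidean_space n) (cone_over S)"
proof -
  let ?z = "\<lambda>_::nat. 0::real"
  let ?U = "Eucl n \<inter> - {?z}"
  let ?g = "\<lambda>x j. x j / l2norm n x"
  have nz: "l2norm n y \<noteq> 0" if "y \<in> ?U" for y using that l2norm_eq_0_iff by blast
  have "continuous_on ?U ?g"
    using nz by (intro continuous_on_coordinatewise_then_product continuous_intros) auto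
  then have "openin (top_of_set ?U) (?U \<inter> ?g -` (- S))"
    using compact_imp_closed[OF cl] by (intro continuous_openin_preimage_gen) auto
  moreover have "openin (top_of_set (Eucl n)) ?U"
    by (intro openin_open_Int) auto
  ultimately have op: "openin (top_of_set (Eucl n)) (?U \<inter> ?g -` (- S))"
    using openin_trans by blast
  have "?g x \<in> S \<longleftrightarrow> x \<in> cone_over S" if "x \<in> ?U" for x
  proof -
    have u: "?g x \<in> unit_sphere n" using that normalize_in_unit_sphere by blast
    have pos: "0 < l2norm n x" using nz[OF that] l2norm_nonneg[of n x] by linarith
    then have "x = (\<lambda>i. l2norm n x * ?g x i)" by auto
    then show ?thesis
      using cone_over_scale[of "?g x" S "l2norm n x"] pos scaled_in_cone_over[OF S u pos] by auto
  qed
  then have "?U \<inter> ?g -` (- S) = Eucl n - cone_over S"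
    using zero_in_cone_over by auto
  then show ?thesis
    using op cone_over_subset_Eucl[OF S]
    by (simp add: Euclidean_space_eq closedin_def)
qed

section \<open>Separation of Euclidean space by closed sets\<close>

lemma connected_complement_iff:
  assumes "closedin (Euclidean_space n) S" "closedin (Euclidean_space n) T" "S homeomorphic T"
  shows "connected (Eucl n - S) \<longleftrightarrow> connected (Eucl n - T)"
proof -
  have sub: "S \<subseteq> Eucl n" "T \<subseteq> Eucl n"
    using assms by (auto simp: closedin_Euclidean_space_iff topspace_Euclidean_space Eucl_def)
  then have "subtopology (Euclidean_space n) S homeomorphic_space subtopology (Euclidean_space n) T"
    using assms(3)
    by (simp add: Euclidean_space_eq subtopology_subtopology Int_absorb1)
  \<comment> \<open>This is the homological input: for homeomorphic closed subsets of R^n, either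
    both complements are connected or neither is.\<close>
  from connected_in_Euclidean_complements[OF assms(1,2) this] show ?thesis
    by (simp add: Euclidean_space_eq connectedin_subtopology)
qed

lemma connected_component_segment:
  fixes x y :: "'i \<Rightarrow> real"
  assumes "\<And>u. 0 \<le> u \<Longrightarrow> u \<le> 1 \<Longrightarrow> (\<lambda>i. (1 - u) * x i + u * y i) \<in> S"
  shows "connected_component S x y"
proof -
  let ?p = "\<lambda>u i. (1 - u) * x i + u * y i"
  have "connected (?p ` {0..1})"
    by (intro connected_continuous_image continuous_on_coordinatewise_then_product continuous_intros)
      simp
  moreover have "x \<in> ?p ` {0..1}" by (rule image_eqI[of _ _ 0]) auto
  moreover have "y \<in> ?p ` {0..1}" by (rule image_eqI[of _ _ 1]) auto
  ultimately show ?thesis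
    unfolding connected_component_def using assms by (intro exI[of _ "?p ` {0..1}"]) auto
qed

lemma not_connected_hyperplane_complement: "\<not> connected (Eucl (Suc n) - Eucl n)"
proof
  assume "connected (Eucl (Suc n) - Eucl n)"
  then have c: "connected ((\<lambda>x. x n) ` (Eucl (Suc n) - Eucl n))"
    by (intro connected_continuous_image continuous_intros)
  have e: "(\<lambda>i. if i = n then a else 0) \<in> Eucl (Suc n) - Eucl n" if "a \<noteq> 0" for a :: real
    using that by (auto simp: Eucl_def)
  have "a \<in> (\<lambda>x. x n) ` (Eucl (Suc n) - Eucl n)" if "a \<noteq> 0" for a :: real
    using imageI[OF e[OF that], of "\<lambda>x. x n"] by simp
  \<comment> \<open>The last coordinate takes the values -1 and 1 on the complement, so
    connectedness would make it vanish somewhere.\<close>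
  from connectedD_interval[OF c this[of "-1"] this[of 1], of 0]
  obtain x where "x \<in> Eucl (Suc n) - Eucl n" "x n = 0" by auto
  then show False by (auto simp: Eucl_def) (metis le_antisym not_less_eq_eq)
qed

text \<open>A point \<open>p\<close> of the hyperplane outside \<open>Z\<close> serves as a gate:
  points off the hyperplane reach it along a segment, and points in the hyperplane first step off it
  in the normal direction.\<close>

lemma connected_proper_hyperplane_subset_complement:
  assumes Z: "Z \<subset> Eucl n"
  shows "connected (Eucl (Suc n) - Z)"
proof -
  let ?S = "Eucl (Suc n) - Z"
  obtain p where p: "p \<in> Eucl n" "p \<notin> Z" using Z by blast
  have off: "x \<notin> Z" if "x n \<noteq> 0" for x using that Z by (auto simp: Eucl_def)
  have to_p: "connected_component ?S x p" if x: "x \<in> Eucl (Suc n)" "x n \<noteq> 0" for x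
  proof (rule connected_component_segment)
    fix u :: real assume u: "0 \<le> u" "u \<le> 1"
    let ?y = "\<lambda>i. (1 - u) * x i + u * p i"
    have "?y \<notin> Z"
    proof (cases "u = 1")
      case False
      then show ?thesis using x p by (intro off) (simp add: Eucl_def)
    qed (use p in simp)
    then show "?y \<in> ?S" using x p by (simp add: Eucl_def)
  qed
  have "connected_component ?S x p" if x: "x \<in> ?S" for x
  proof (cases "x n = 0")
    case False
    then show ?thesis using to_p x by blast
  next
    case True
    let ?x' = "x(n := 1)"
    have "connected_component ?S x ?x'"
    proof (rule connected_component_segment)
      fix u :: real assume u: "0 \<le> u" "u \<le> 1"
      let ?y = "\<lambda>i. (1 - u) * x i + u * ?x' i"
      have "?y \<notin> Z"
      proof (cases "u = 0")
        case False
        then show ?thesis using True by (intro off) simp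
      qed (use x in simp)
      then show "?y \<in> ?S" using x by (simp add: Eucl_def)
    qed
    moreover have "connected_component ?S ?x' p"
      using x by (intro to_p) (auto simp: Eucl_def)
    ultimately show ?thesis by (rule connected_component_trans)
  qed
  then show ?thesis
    by (meson connected_iff_connected_component connected_component_sym connected_component_trans)
qed

subsection \<open>Complete simplicial fans\<close>

text \<open>Barycentric coordinates without normalization: the infinite cone over the realization,
  with apex 0. This allows a whole vector space, and not only a sphere, as its image.\<close>

definition conic_realization :: "'a set set \<Rightarrow> ('a \<Rightarrow> real) set" where
  "conic_realization K = {t. (\<forall>v. 0 \<le> t v) \<and> {v. t v \<noteq> 0} \<in> K}"

definition realization_set :: "'a set set \<Rightarrow> ('a \<Rightarrow> real) set" where
  "realization_set K = {t \<in> conic_realization K. (\<Sum>v\<in>vertices K. t v) = 1}"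

definition vertex_comb :: "'a set set \<Rightarrow> ('a \<Rightarrow> nat \<Rightarrow> real) \<Rightarrow> ('a \<Rightarrow> real) \<Rightarrow> nat \<Rightarrow> real" where
  "vertex_comb K f t = (\<lambda>i. \<Sum>v\<in>vertices K. t v * f v i)"

lemma geometric_realization_eq: "geometric_realization K = top_of_set (realization_set K)"
  by (simp add: geometric_realization_def realization_set_def conic_realization_def
      euclidean_product_topology)

lemma simplicial_sphere_iff:
  "simplicial_sphere d K \<longleftrightarrow>
     simplicial_complex K \<and> realization_set K homeomorphic unit_sphere (Suc d)"
  by (simp add: simplicial_sphere_def geometric_realization_eq nsphere_eq)

lemma finite_vertices: "simplicial_complex K \<Longrightarrow> finite (vertices K)"
  by (simp add: simplicial_complex_def vertices_def)

lemma empty_in_complex: "simplicial_complex K \<Longrightarrow> {} \<in> K"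
  by (simp add: simplicial_complex_def)

lemma face_subset: "simplicial_complex K \<Longrightarrow> F \<in> K \<Longrightarrow> G \<subseteq> F \<Longrightarrow> G \<in> K"
  by (auto simp: simplicial_complex_def)

lemma singleton_face: "simplicial_complex K \<Longrightarrow> v \<in> vertices K \<Longrightarrow> {v} \<in> K"
  by (auto simp: vertices_def intro: face_subset)

lemma vertices_mono: "L \<subseteq> K \<Longrightarrow> vertices L \<subseteq> vertices K"
  by (auto simp: vertices_def)

lemma support_subset_vertices:
  "t \<in> conic_realization K \<Longrightarrow> t v \<noteq> 0 \<Longrightarrow> v \<in> vertices K"
  by (auto simp: conic_realization_def vertices_def)

lemma sum_over_larger_vertex_set:
  assumes "t \<in> conic_realization L" "L \<subseteq> K" "simplicial_complex K"
  shows "(\<Sum>v\<in>vertices K. t v * c v) = (\<Sum>v\<in>vertices L. t v * (c v :: real))"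
  using assms support_subset_vertices[OF assms(1)] vertices_mono[OF assms(2)] finite_vertices
  by (intro sum.mono_neutral_right) auto

lemma realization_set_subcomplex:
  assumes "L \<subseteq> K" "simplicial_complex K"
  shows "realization_set L = conic_realization L \<inter> realization_set K"
  using assms sum_over_larger_vertex_set[OF _ assms, of _ "\<lambda>_. 1"]
  by (auto simp: realization_set_def conic_realization_def)

lemma compact_realization_set:
  assumes K: "simplicial_complex K"
  shows "compact (realization_set K)"
proof -
  let ?V = "vertices K"
  let ?S = "\<lambda>F. (\<Inter>v. {t. 0 \<le> t v}) \<inter> (\<Inter>v\<in>-F. {t. t v = 0}) \<inter> {t. (\<Sum>v\<in>?V. t v) = (1::real)}"
  \<comment> \<open>There is one closed set for each of the finitely many faces; compactness then
    follows inside a product of unit intervals.\<close>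
  have "realization_set K = (\<Union>F\<in>K. ?S F)"
  proof safe
    fix t assume "t \<in> realization_set K"
    then show "t \<in> (\<Union>F\<in>K. ?S F)"
      by (intro UN_I[of "{v. t v \<noteq> 0}"]) (auto simp: realization_set_def conic_realization_def)
  next
    fix t F assume F: "F \<in> K" "t \<in> (\<Inter>v. {t. 0 \<le> t v})" "t \<in> (\<Inter>v\<in>-F. {t. t v = 0})"
      and sum: "(\<Sum>v\<in>?V. t v) = (1::real)"
    then have "{v. t v \<noteq> 0} \<in> K" by (intro face_subset[OF K F(1)]) auto
    then show "t \<in> realization_set K"
      using F sum by (simp add: realization_set_def conic_realization_def)
  qed
  moreover have "closed (?S F)" for F
    by (intro closed_Int closed_INT ballI closed_Collect_le closed_Collect_eq continuous_intros)
  moreover have "finite K" using K by (simp add: simplicial_complex_def)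
  ultimately have "closed (realization_set K)" by (metis (no_types, lifting) closed_UN)
  moreover have "compact (PiE UNIV (\<lambda>_::'a. {0..1::real}))"
    using compactin_PiE[of "\<lambda>_. euclideanreal" UNIV "\<lambda>_::'a. {0..1}"]
    by (simp add: euclidean_product_topology)
  moreover have "realization_set K \<subseteq> PiE UNIV (\<lambda>_::'a. {0..1})"
  proof
    fix t assume t: "t \<in> realization_set K"
    have "t v \<le> 1" for v
    proof (cases "t v = 0")
      case False
      then have "t v \<le> (\<Sum>v\<in>?V. t v)"
        using t support_subset_vertices[of t K v] finite_vertices[OF K]
        by (intro member_le_sum) (auto simp: realization_set_def conic_realization_def)
      then show ?thesis using t by (simp add: realization_set_def)
    qed simp
    then show "t \<in> PiE UNIV (\<lambda>_::'a. {0..1})"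
      using t by (auto simp: realization_set_def conic_realization_def)
  qed
  ultimately show ?thesis using compact_Int_closed by (metis inf.absorb_iff2)
qed

text \<open>Bijectivity onto \<open>Eucl n\<close> encodes both halves of completeness: the cones
  spanned by the faces cover the space, and they overlap only in cones of common faces. Continuity
  of the inverse on the realization comes later from compactness.\<close>

locale complete_fan =
  fixes n :: nat and K :: "'a set set" and f :: "'a \<Rightarrow> nat \<Rightarrow> real"
  assumes complex: "simplicial_complex K"
    and bij: "bij_betw (vertex_comb K f) (conic_realization K) (Eucl n)"
begin

abbreviation "comb \<equiv> vertex_comb K f"

definition cell :: "'a set set \<Rightarrow> (nat \<Rightarrow> real) set" where
  "cell L = comb ` conic_realization L"

definition sphere_map :: "('a \<Rightarrow> real) \<Rightarrow> nat \<Rightarrow> real" where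
  "sphere_map t = (\<lambda>i. comb t i / l2norm n (comb t))"

lemma comb_linear: "comb (\<lambda>v. a * s v + b * t v) = (\<lambda>i. a * comb s i + b * comb t i)"
  by (simp add: vertex_comb_def sum.distrib sum_distrib_left distrib_right mult.assoc)

lemma comb_scale: "comb (\<lambda>v. a * s v) = (\<lambda>i. a * comb s i)"
  using comb_linear[of a s 0 s] by simp

lemma continuous_on_comb: "continuous_on S comb"
  unfolding vertex_comb_def[abs_def]
  by (intro continuous_on_coordinatewise_then_product continuous_intros)

lemma comb_in_Eucl: "t \<in> conic_realization K \<Longrightarrow> comb t \<in> Eucl n"
  using bij by (auto simp: bij_betw_def)

lemma zero_in_conic: "simplicial_complex L \<Longrightarrow> (\<lambda>_. 0) \<in> conic_realization L"
  by (simp add: conic_realization_def empty_in_complex)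

lemma comb_zero: "comb (\<lambda>_. 0) = (\<lambda>_. 0)"
  by (simp add: vertex_comb_def)

lemma comb_eq_iff:
  "s \<in> conic_realization K \<Longrightarrow> t \<in> conic_realization K \<Longrightarrow> comb s = comb t \<longleftrightarrow> s = t"
  using bij by (auto simp: bij_betw_def inj_on_eq_iff)

lemma conic_scale: "t \<in> conic_realization L \<Longrightarrow> 0 < r \<Longrightarrow> (\<lambda>v. r * t v) \<in> conic_realization L"
  by (simp add: conic_realization_def)

lemma realization_nonzero: "t \<in> realization_set L \<Longrightarrow> t \<noteq> (\<lambda>_. 0)"
  by (auto simp: realization_set_def)

lemma conic_eq_scaled:
  assumes "t \<in> conic_realization K" "t \<noteq> (\<lambda>_. 0)"
  obtains r s where "0 < r" "s \<in> realization_set K" "t = (\<lambda>v. r * s v)"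
proof -
  let ?r = "\<Sum>v\<in>vertices K. t v"
  obtain v where v: "t v \<noteq> 0" using assms(2) by auto
  have nn: "0 \<le> t w" for w using assms(1) by (simp add: conic_realization_def)
  then have "t v \<le> ?r" and "0 < t v"
    using v support_subset_vertices[OF assms(1) v] finite_vertices[OF complex]
    by (auto intro!: member_le_sum simp: less_le)
  then have pos: "0 < ?r" by linarith
  have "(\<lambda>v. inverse ?r * t v) \<in> conic_realization K"
    using conic_scale[OF assms(1)] pos by simp
  moreover have "(\<Sum>v\<in>vertices K. inverse ?r * t v) = 1"
    using pos by (simp flip: sum_distrib_left)
  ultimately have "(\<lambda>v. inverse ?r * t v) \<in> realization_set K" by (simp add: realization_set_def)
  moreover have "t = (\<lambda>v. ?r * (inverse ?r * t v))" using pos by (auto simp: field_simps)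
  ultimately show thesis using that pos by blast
qed

lemma l2norm_comb_pos: "t \<in> realization_set K \<Longrightarrow> 0 < l2norm n (comb t)"
  using comb_eq_iff[of t "\<lambda>_. 0"] l2norm_eq_0_iff[of "comb t" n] comb_in_Eucl[of t]
    realization_nonzero[of t K] zero_in_conic[OF complex] l2norm_nonneg[of n "comb t"]
  by (auto simp: realization_set_def comb_zero less_le)

lemma comb_eq_scaled_sphere_map:
  "t \<in> realization_set K \<Longrightarrow> comb t = (\<lambda>i. l2norm n (comb t) * sphere_map t i)"
  using l2norm_comb_pos[of t] by (auto simp: sphere_map_def)

lemma sphere_map_in_sphere: "t \<in> realization_set K \<Longrightarrow> sphere_map t \<in> unit_sphere n"
  unfolding sphere_map_def using l2norm_comb_pos[of t] comb_in_Eucl[of t]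
  by (intro normalize_in_unit_sphere) (auto simp: realization_set_def l2norm_def)

text \<open>Points with equal directions have proportional images; injectivity and homogeneity of
  \<open>comb\<close> make their coordinates proportional as well, and both coordinate sums are
  1.\<close>

lemma inj_on_sphere_map: "inj_on sphere_map (realization_set K)"
proof (rule inj_onI)
  fix s t assume st: "s \<in> realization_set K" "t \<in> realization_set K" "sphere_map s = sphere_map t"
  define r where "r = l2norm n (comb s) / l2norm n (comb t)"
  have r: "0 < r" using st l2norm_comb_pos by (simp add: r_def)
  have "comb s i = r * comb t i" for i
    using fun_cong[OF st(3), of i] l2norm_comb_pos[OF st(1)] l2norm_comb_pos[OF st(2)]
    by (simp add: sphere_map_def r_def field_simps)
  then have "comb s = (\<lambda>i. r * comb t i)" by blast
  then have eq: "s = (\<lambda>v. r * t v)"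
    using st r comb_eq_iff[of s "\<lambda>v. r * t v"] conic_scale[of t K r]
    by (simp add: comb_scale realization_set_def)
  then have "1 = r * (\<Sum>v\<in>vertices K. t v)"
    using st(1) by (simp add: realization_set_def flip: sum_distrib_left)
  then show "s = t" using st(2) eq by (simp add: realization_set_def)
qed

text \<open>A continuous injection of a compact space into a Hausdorff space is a homeomorphism onto
  its image. Surjectivity comes from rescaling a preimage under \<open>comb\<close> to coordinate
  sum 1.\<close>

lemma homeomorphism_sphere_map:
  "\<exists>g. homeomorphism (realization_set K) (unit_sphere n) sphere_map g"
proof (rule homeomorphism_compact[OF compact_realization_set[OF complex] _ _ inj_on_sphere_map])
  show "continuous_on (realization_set K) sphere_map"
    unfolding sphere_map_def[abs_def]
    using l2norm_comb_pos
    by (intro continuous_on_coordinatewise_then_product continuous_on_divide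
        continuous_on_product_then_coordinatewise[OF continuous_on_comb]
        continuous_on_compose2[OF continuous_on_l2norm continuous_on_comb]) force+
  show "sphere_map ` realization_set K = unit_sphere n"
  proof
    show "unit_sphere n \<subseteq> sphere_map ` realization_set K"
    proof
      fix x assume x: "x \<in> unit_sphere n"
      then have "x \<in> comb ` conic_realization K"
        using bij_betw_imp_surj_on[OF bij] by (simp add: unit_sphere_def)
      then obtain t where t: "t \<in> conic_realization K" "comb t = x" by blast
      with x obtain r s where rs: "0 < r" "s \<in> realization_set K" "t = (\<lambda>v. r * s v)"
        using conic_eq_scaled comb_zero unit_sphere_nonzero by metis
      have "l2norm n (\<lambda>i. r * comb s i) = 1"
        using x t rs(3) by (simp add: comb_scale unit_sphere_def)
      then have "r * l2norm n (comb s) = 1" using rs(1) by (simp add: l2norm_scale)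
      then have "sphere_map s = (\<lambda>i. r * comb s i)"
        using l2norm_comb_pos[OF rs(2)]
        by (auto simp: sphere_map_def field_simps)
      then show "x \<in> sphere_map ` realization_set K"
        using rs t by (auto simp: comb_scale)
    qed
  qed (use sphere_map_in_sphere in blast)
qed

theorem simplicial_sphere_of_fan: "n = Suc d \<Longrightarrow> simplicial_sphere d K"
  using homeomorphism_sphere_map complex by (auto simp: simplicial_sphere_iff homeomorphic_def)

text \<open>Brings the region covered by a subcomplex into the form to which the results on
  \<open>cone_over\<close> apply.\<close>

lemma cell_eq_cone_over:
  assumes L: "simplicial_complex L" "L \<subseteq> K"
  shows "cell L = cone_over (sphere_map ` realization_set L)"
proof -
  note R = realization_set_subcomplex[OF L(2) complex]
  have "comb t \<in> cone_over (sphere_map ` realization_set L)" if t: "t \<in> conic_realization L" for t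
  proof (cases "t = (\<lambda>_. 0)")
    case False
    have "t \<in> conic_realization K" using t L(2) by (auto simp: conic_realization_def)
    with False obtain r s where rs: "0 < r" "s \<in> realization_set K" "t = (\<lambda>v. r * s v)"
      using conic_eq_scaled by metis
    then have "s \<in> realization_set L"
      using t R by (auto simp: conic_realization_def realization_set_def)
    moreover have "comb t = (\<lambda>i. (r * l2norm n (comb s)) * sphere_map s i)"
      using rs(3) comb_eq_scaled_sphere_map[OF rs(2)] by (metis comb_scale mult.assoc)
    moreover have "0 < r * l2norm n (comb s)" using rs l2norm_comb_pos by simp
    ultimately show ?thesis by (metis cone_over_scale imageI)
  qed (simp add: comb_zero zero_in_cone_over)
  moreover have "x \<in> cell L" if "x \<in> cone_over (sphere_map ` realization_set L)" for x
    using that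
  proof (cases rule: cone_over_cases)
    case 1
    then show ?thesis
      unfolding cell_def using zero_in_conic[OF L(1)] comb_zero by (metis imageI)
  next
    case (2 r y)
    then obtain s where s: "s \<in> realization_set L" "y = sphere_map s" by blast
    then have "s \<in> realization_set K" using R by blast
    then have pos: "0 < l2norm n (comb s)" by (rule l2norm_comb_pos)
    have "x = comb (\<lambda>v. (r / l2norm n (comb s)) * s v)"
      unfolding comb_scale using 2 s by (simp add: sphere_map_def)
    moreover have "(\<lambda>v. (r / l2norm n (comb s)) * s v) \<in> conic_realization L"
      using s(1) 2(1) pos by (intro conic_scale) (auto simp: realization_set_def)
    ultimately show ?thesis unfolding cell_def by blast
  qed
  ultimately show ?thesis by (auto simp: cell_def)
qed

lemma sphere_map_realization_homeomorphic:
  assumes L: "simplicial_complex L" "L \<subseteq> K"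
  shows "sphere_map ` realization_set L homeomorphic realization_set L"
    and "sphere_map ` realization_set L \<subseteq> unit_sphere n"
    and "compact (sphere_map ` realization_set L)"
proof -
  have sub: "realization_set L \<subseteq> realization_set K"
    using realization_set_subcomplex[OF L(2) complex] by blast
  obtain g where g: "homeomorphism (realization_set K) (unit_sphere n) sphere_map g"
    using homeomorphism_sphere_map by blast
  show img: "sphere_map ` realization_set L \<subseteq> unit_sphere n"
    using sub sphere_map_in_sphere by blast
  have "homeomorphism (realization_set L) (sphere_map ` realization_set L) sphere_map g"
    using homeomorphism_of_subsets[OF g sub img] by blast
  then have "realization_set L homeomorphic sphere_map ` realization_set L"
    unfolding homeomorphic_def by blast
  then show "sphere_map ` realization_set L homeomorphic realization_set L"
    and "compact (sphere_map ` realization_set L)"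
    using homeomorphic_sym homeomorphic_compactness compact_realization_set[OF L(1)] by metis+
qed

lemma closedin_cell:
  "simplicial_complex L \<Longrightarrow> L \<subseteq> K \<Longrightarrow> closedin (Euclidean_space n) (cell L)"
  by (simp add: cell_eq_cone_over closed_cone_over sphere_map_realization_homeomorphic)

text \<open>The homeomorphism of \<open>E\<close> with the great sphere
  \<open>unit_sphere (Suc m)\<close> carries \<open>L\<close> to a subset of it. Extended to cones,
  it makes \<open>cell L\<close> homeomorphic to a closed subset of a hyperplane, and such a subset
  separates exactly if it is the entire hyperplane.\<close>

lemma connected_complement_cell_iff:
  assumes n: "n = Suc (Suc m)"
    and E: "simplicial_complex E" "E \<subseteq> K" and L: "simplicial_complex L" "L \<subseteq> E"
    and sphere: "realization_set E homeomorphic unit_sphere (Suc m)"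
  shows "connected (Eucl n - cell L) \<longleftrightarrow> realization_set L \<noteq> realization_set E"
proof -
  obtain g h where g: "homeomorphism (realization_set E) (unit_sphere (Suc m)) g h"
    using sphere by (auto simp: homeomorphic_def)
  let ?T = "g ` realization_set L"
  have LK: "L \<subseteq> K" using E L by blast
  have sub: "realization_set L \<subseteq> realization_set E"
    using realization_set_subcomplex[OF L(2) E(1)] by blast
  then have T: "?T \<subseteq> unit_sphere (Suc m)" using g by (auto simp: homeomorphism_def)
  then have T': "?T \<subseteq> unit_sphere n" using n unit_sphere_mono[of "Suc m" n] by simp
  have LT: "homeomorphism (realization_set L) ?T g h"
    using homeomorphism_of_subsets[OF g sub] T by blast
  then have "compact ?T"
    using compact_realization_set[OF L(1)] homeomorphic_compactness homeomorphic_def by blast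
  then have clT: "closedin (Euclidean_space n) (cone_over ?T)" by (rule closed_cone_over[OF T'])
  have "realization_set L homeomorphic ?T" using LT homeomorphic_def by blast
  then have "sphere_map ` realization_set L homeomorphic ?T"
    by (rule homeomorphic_trans[OF sphere_map_realization_homeomorphic(1)[OF L(1) LK]])
  then have "cell L homeomorphic cone_over ?T"
    using sphere_map_realization_homeomorphic(2)[OF L(1) LK] T'
    by (simp add: cell_eq_cone_over[OF L(1) LK] homeomorphic_cone_over)
  then have "connected (Eucl n - cell L) \<longleftrightarrow> connected (Eucl n - cone_over ?T)"
    using closedin_cell[OF L(1) LK] clT by (intro connected_complement_iff)
  also have "\<dots> \<longleftrightarrow> cone_over ?T \<noteq> Eucl (Suc m)"
    using not_connected_hyperplane_complement[of "Suc m"] cone_over_subset_Eucl[OF T] n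
      connected_proper_hyperplane_subset_complement[of "cone_over ?T" "Suc m"]
    by auto
  also have "cone_over ?T = Eucl (Suc m) \<longleftrightarrow> ?T = unit_sphere (Suc m)"
  proof
    assume "cone_over ?T = Eucl (Suc m)"
    then have "x \<in> ?T" if "x \<in> unit_sphere (Suc m)" for x
      using scaled_in_cone_over[OF T that, of 1] that by (simp add: unit_sphere_def)
    then show "?T = unit_sphere (Suc m)" using T by blast
  qed (metis cone_over_unit_sphere)
  also have "?T = unit_sphere (Suc m) \<longleftrightarrow> realization_set L = realization_set E"
  proof
    assume eq: "?T = unit_sphere (Suc m)"
    have "h ` ?T = realization_set L" using LT by (simp add: homeomorphism_def)
    moreover have "h ` unit_sphere (Suc m) = realization_set E" using g by (simp add: homeomorphism_def)
    ultimately show "realization_set L = realization_set E" using eq by simp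
  qed (use g in \<open>simp add: homeomorphism_def\<close>)
  finally show ?thesis .
qed

end

section \<open>Combinatorial consequences of an induced equator\<close>

lemma induced_subcomplex_complex:
  "simplicial_complex K \<Longrightarrow> simplicial_complex (induced_subcomplex K W)"
  by (auto simp: simplicial_complex_def induced_subcomplex_def)

context complete_fan
begin

definition vertex_coord :: "'a \<Rightarrow> 'a \<Rightarrow> real" where
  "vertex_coord u = (\<lambda>v. of_bool (v = u))"

lemma vertex_coord_conic: "{u} \<in> L \<Longrightarrow> vertex_coord u \<in> conic_realization L"
  by (simp add: conic_realization_def vertex_coord_def)

text \<open>By injectivity of \<open>comb\<close>, the position of a point relative to a subcomplex
  depends only on the support of its coordinates.\<close>

lemma comb_in_cell_iff:
  assumes "t \<in> conic_realization K" "L \<subseteq> K"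
  shows "comb t \<in> cell L \<longleftrightarrow> {v. t v \<noteq> 0} \<in> L"
proof
  assume "comb t \<in> cell L"
  then obtain s where s: "s \<in> conic_realization L" "comb t = comb s" by (auto simp: cell_def)
  then have "s \<in> conic_realization K" using assms(2) by (auto simp: conic_realization_def)
  then show "{v. t v \<noteq> 0} \<in> L" using s assms(1) comb_eq_iff by (auto simp: conic_realization_def)
qed (use assms in \<open>auto simp: cell_def conic_realization_def\<close>)

lemma comb_vertex_coord_in_cell_iff:
  "{u} \<in> K \<Longrightarrow> L \<subseteq> K \<Longrightarrow> comb (vertex_coord u) \<in> cell L \<longleftrightarrow> {u} \<in> L"
  by (simp add: comb_in_cell_iff vertex_coord_conic) (simp add: vertex_coord_def)

lemma Eucl_cases:
  assumes "x \<in> Eucl n"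
  obtains t where "t \<in> conic_realization K" "x = comb t"
proof -
  have "x \<in> comb ` conic_realization K"
    using assms bij_betw_imp_surj_on[OF bij] by simp
  then show thesis using that by blast
qed

text \<open>The segment stays in the cone of one face, and all its points after the start have the
  vertex \<open>u\<close> outside \<open>W\<close> in their support, so it avoids the cell of the
  induced subcomplex.\<close>

lemma connected_component_to_vertex:
  assumes t: "t \<in> conic_realization K" "{v. t v \<noteq> 0} \<notin> induced_subcomplex K W"
    and u: "u \<notin> W" "insert u {v. t v \<noteq> 0} \<in> K"
  shows "connected_component (Eucl n - cell (induced_subcomplex K W)) (comb t) (comb (vertex_coord u))"
proof (rule connected_component_segment)
  fix a :: real assume a: "0 \<le> a" "a \<le> 1"
  let ?s = "\<lambda>v. (1 - a) * t v + a * vertex_coord u v"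
  have nn: "0 \<le> t v" for v using t by (simp add: conic_realization_def)
  \<comment> \<open>Both summands are nonnegative, so nothing cancels and the support is known
    exactly.\<close>
  then have s0: "?s v = 0 \<longleftrightarrow> (a = 1 \<or> t v = 0) \<and> (a = 0 \<or> v \<noteq> u)" for v
    using a by (auto simp: vertex_coord_def add_nonneg_eq_0_iff)
  have "{v. ?s v \<noteq> 0} \<in> K"
    by (rule face_subset[OF complex u(2)]) (use s0 in auto)
  then have sK: "?s \<in> conic_realization K"
    using a nn by (simp add: conic_realization_def vertex_coord_def)
  have "{v. ?s v \<noteq> 0} \<notin> induced_subcomplex K W"
  proof (cases "a = 0")
    case True
    then show ?thesis using t(2) by simp
  next
    case False
    then have "u \<in> {v. ?s v \<noteq> 0}" using s0 by blast
    then show ?thesis using u(1) by (auto simp: induced_subcomplex_def)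
  qed
  moreover have "induced_subcomplex K W \<subseteq> K" by (auto simp: induced_subcomplex_def)
  ultimately have "comb ?s \<in> Eucl n - cell (induced_subcomplex K W)"
    using sK comb_in_cell_iff comb_in_Eucl by blast
  then show "(\<lambda>i. (1 - a) * comb t i + a * comb (vertex_coord u) i)
      \<in> Eucl n - cell (induced_subcomplex K W)"
    by (simp only: comb_linear)
qed

text \<open>The cell of the equator separates the space. Every point outside it is joined to a
  vertex outside \<open>W\<close>, and adjacent vertices outside \<open>W\<close> are joined to each
  other; so sorting these vertices by component yields the two parts.\<close>

theorem complement_of_equator_disconnected:
  assumes n: "n = Suc (Suc m)" and sphere: "simplicial_sphere m (induced_subcomplex K W)"
  obtains U1 U2 where "U1 \<noteq> {}" "U2 \<noteq> {}" "U1 \<union> U2 = vertices K - W"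
    "\<And>u1 u2. u1 \<in> U1 \<Longrightarrow> u2 \<in> U2 \<Longrightarrow> {u1, u2} \<notin> K"
proof -
  let ?E = "induced_subcomplex K W"
  let ?S = "Eucl n - cell ?E"
  have EK: "?E \<subseteq> K" by (auto simp: induced_subcomplex_def)
  have "\<not> connected ?S"
    using connected_complement_cell_iff[OF n _ EK _ subset_refl] sphere
    by (simp add: simplicial_sphere_iff)
  then obtain x y where xy: "x \<in> ?S" "y \<in> ?S" "\<not> connected_component ?S x y"
    using connected_iff_connected_component by blast
  have to_vertex: "\<exists>u\<in>vertices K - W. connected_component ?S z (comb (vertex_coord u))"
    if z: "z \<in> ?S" for z
  proof -
    obtain t where t: "t \<in> conic_realization K" "z = comb t" using z Eucl_cases by blast
    then have tE: "{v. t v \<noteq> 0} \<notin> ?E" using z comb_in_cell_iff[OF _ EK] by blast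
    moreover have tK: "{v. t v \<noteq> 0} \<in> K" using t by (simp add: conic_realization_def)
    ultimately obtain u where "t u \<noteq> 0" "u \<notin> W" by (auto simp: induced_subcomplex_def)
    moreover from this have "insert u {v. t v \<noteq> 0} \<in> K" using tK by (simp add: insert_absorb)
    ultimately show ?thesis
      using connected_component_to_vertex[OF t(1) tE] support_subset_vertices[OF t(1)] t(2) by blast
  qed
  obtain u v where u: "u \<in> vertices K - W" "connected_component ?S x (comb (vertex_coord u))"
    and v: "v \<in> vertices K - W" "connected_component ?S y (comb (vertex_coord v))"
    using to_vertex xy by metis
  define U1 where "U1 = {w \<in> vertices K - W. connected_component ?S x (comb (vertex_coord w))}"
  define U2 where "U2 = vertices K - W - U1"
  have "v \<notin> U1"
    using v xy by (auto simp: U1_def dest: connected_component_sym connected_component_trans)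
  moreover have "{u1, u2} \<notin> K" if u1: "u1 \<in> U1" and u2: "u2 \<in> U2" for u1 u2
  proof
    assume e: "{u1, u2} \<in> K"
    have u1': "u1 \<in> vertices K" "u1 \<notin> W" using u1 by (auto simp: U1_def)
    have "connected_component ?S (comb (vertex_coord u1)) (comb (vertex_coord u2))"
    proof (rule connected_component_to_vertex)
      have supp: "{v. vertex_coord u1 v \<noteq> 0} = {u1}" by (simp add: vertex_coord_def)
      show "{v. vertex_coord u1 v \<noteq> 0} \<notin> ?E" "insert u2 {v. vertex_coord u1 v \<noteq> 0} \<in> K"
        using e u1' by (simp_all add: supp induced_subcomplex_def insert_commute)
    qed (use u1' u2 complex in \<open>auto simp: U2_def intro: vertex_coord_conic singleton_face\<close>)
    then have "u2 \<in> U1"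
      using u1 u2 connected_component_trans by (fastforce simp: U1_def U2_def)
    then show False using u2 by (simp add: U2_def)
  qed
  moreover have "u \<in> U1" using u by (simp add: U1_def)
  moreover have "U1 \<union> U2 = vertices K - W" by (auto simp: U1_def U2_def)
  ultimately show thesis using that[of U1 U2] v(1) by (auto simp: U2_def)
qed

text \<open>Removing the open star of \<open>F\<close> from the equator opens a passage between the
  two sides. If no vertex of \<open>U1\<close> formed a face with \<open>F\<close>, the side of
  \<open>U1\<close> would remain sealed off, although the complement has become connected.\<close>

theorem equator_face_extends_to_complement:
  assumes n: "n = Suc (Suc m)" and sphere: "simplicial_sphere m (induced_subcomplex K W)"
    and U: "U1 \<noteq> {}" "U2 \<noteq> {}" "U1 \<union> U2 = vertices K - W"
    and sep: "\<And>u1 u2. u1 \<in> U1 \<Longrightarrow> u2 \<in> U2 \<Longrightarrow> {u1, u2} \<notin> K"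
    and F: "F \<in> induced_subcomplex K W" "F \<noteq> {}"
  shows "\<exists>u\<in>U1. insert u F \<in> K"
proof (rule ccontr)
  assume no_ext: "\<not> (\<exists>u\<in>U1. insert u F \<in> K)"
  let ?E = "induced_subcomplex K W"
  \<comment> \<open>\<open>?L\<close> is the equator without the open star of \<open>F\<close>. If
    \<open>F\<close> has no extension into \<open>U1\<close>, then \<open>?L1\<close> and
    \<open>?L2\<close> cover \<open>K\<close>; they meet in \<open>?L\<close>, so their cells are
    two closed sets that disconnect the complement of \<open>cell ?L\<close>.\<close>
  let ?L1 = "{G \<in> K. G \<inter> U1 = {}}" and ?L2 = "{G \<in> K. G \<inter> U2 = {} \<and> \<not> F \<subseteq> G}"
  let ?L = "{G \<in> ?E. \<not> F \<subseteq> G}"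
  have EK: "?E \<subseteq> K" by (auto simp: induced_subcomplex_def)
  have vK: "\<Union>K = vertices K" by (simp add: vertices_def)
  have face_W: "G \<subseteq> W \<longleftrightarrow> G \<inter> U1 = {} \<and> G \<inter> U2 = {}" if "G \<in> K" for G
    using that U(3) vK by blast
  have L: "simplicial_complex ?L" "simplicial_complex ?L1" "simplicial_complex ?L2"
    using complex F(2) by (auto simp: simplicial_complex_def induced_subcomplex_def)
  have L_eq: "?L = ?L1 \<inter> ?L2" using face_W by (auto simp: induced_subcomplex_def)
  have K_eq: "K = ?L1 \<union> ?L2"
  proof -
    have "G \<in> ?L2" if G: "G \<in> K" "G \<inter> U1 \<noteq> {}" for G
    proof -
      obtain u where u: "u \<in> G" "u \<in> U1" using G by blast
      have "\<not> F \<subseteq> G" using no_ext u face_subset[OF complex G(1), of "insert u F"] by blast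
      moreover have "G \<inter> U2 = {}"
        using sep[OF u(2)] u(1) face_subset[OF complex G(1), of "{u, w}" for w] by blast
      ultimately show ?thesis using G by blast
    qed
    then show ?thesis by blast
  qed
  \<comment> \<open>Injectivity of \<open>comb\<close> lets images commute with
    intersections.\<close>
  have inj: "comb ` (conic_realization ?L1 \<inter> conic_realization ?L2) = cell ?L1 \<inter> cell ?L2"
    unfolding cell_def using bij
    by (intro inj_on_image_Int[of _ "conic_realization K"]) (auto simp: bij_betw_def conic_realization_def)
  have "cell ?L1 \<inter> cell ?L2 = cell ?L"
    unfolding inj[symmetric] unfolding cell_def L_eq
    by (rule arg_cong[of _ _ "image comb"]) (auto simp: conic_realization_def)
  then have disj: "cell ?L1 \<inter> cell ?L2 \<inter> (Eucl n - cell ?L) = {}" by blast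
  have "conic_realization K = conic_realization (?L1 \<union> ?L2)"
    using K_eq by (rule arg_cong)
  also have "\<dots> = conic_realization ?L1 \<union> conic_realization ?L2"
    by (auto simp: conic_realization_def)
  finally have "cell K = cell ?L1 \<union> cell ?L2"
    unfolding cell_def image_Un[symmetric] by (rule arg_cong)
  then have cover: "Eucl n - cell ?L \<subseteq> cell ?L1 \<union> cell ?L2"
    using bij_betw_imp_surj_on[OF bij] by (auto simp: cell_def)
  have closed: "closed (cell ?L1)" "closed (cell ?L2)"
    using closedin_cell[OF L(2)] closedin_cell[OF L(3)] closedin_Euclidean_imp_closed by blast+
  obtain u1 u2 where u: "u1 \<in> U1" "u2 \<in> U2" using U by blast
  then have uK: "{u1} \<in> K" "{u2} \<in> K" "u1 \<notin> W" "u2 \<notin> W"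
    using U(3) singleton_face[OF complex] by blast+
  have FW: "F \<in> K" "F \<subseteq> W" using F(1) by (auto simp: induced_subcomplex_def)
  have sep': "u2 \<notin> U1" "u1 \<notin> U2" using sep[of u2 u2] sep[of u1 u1] u uK by auto
  have "comb (vertex_coord u2) \<in> cell ?L1 \<inter> (Eucl n - cell ?L)"
    using uK u sep' comb_in_Eucl[OF vertex_coord_conic]
    by (auto simp: comb_vertex_coord_in_cell_iff subset_iff induced_subcomplex_def)
  moreover have "comb (vertex_coord u1) \<in> cell ?L2 \<inter> (Eucl n - cell ?L)"
    using uK u sep' FW F(2) comb_in_Eucl[OF vertex_coord_conic]
    by (auto simp: comb_vertex_coord_in_cell_iff subset_iff induced_subcomplex_def)
  ultimately have "\<not> connected (Eucl n - cell ?L)"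
    unfolding connected_closed using closed cover disj by blast
  then have "realization_set ?L = realization_set ?E"
    using connected_complement_cell_iff[OF n _ EK L(1)] sphere
    by (auto simp: simplicial_sphere_iff)
  \<comment> \<open>The witness is the barycentre of \<open>F\<close>: its support is
    \<open>F\<close> itself, which is a face of the equator but not of \<open>?L\<close>.\<close>
  moreover have "(\<lambda>v. of_bool (v \<in> F) / card F) \<in> realization_set ?E - realization_set ?L"
  proof -
    have fin: "finite F" using FW complex by (simp add: simplicial_complex_def)
    then have c: "card F \<noteq> 0" using F(2) by simp
    have "F \<subseteq> vertices ?E" using F(1) by (auto simp: vertices_def)
    then have "(\<Sum>v\<in>vertices ?E. of_bool (v \<in> F) / card F) = (\<Sum>v\<in>F. 1 / real (card F))"
      using finite_vertices[OF induced_subcomplex_complex[OF complex]]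
      by (intro sum.mono_neutral_cong_right) auto
    then show ?thesis
      using c F by (auto simp: realization_set_def conic_realization_def)
  qed
  ultimately show False by blast
qed

end

subsection \<open>Fans of convex polytopes and of joins\<close>

text \<open>\<open>\<beta> c\<close> is the basis dual to the vertices of the facet
  \<open>supp c\<close>; its sum is the supporting functional, 1 on that facet and smaller at all
  other vertices. Existence of coordinates comes from a facet whose functional is largest at the
  point, uniqueness from comparing coefficient sums.\<close>

theorem complete_fan_of_convex_polytope:
  fixes f :: "'a \<Rightarrow> nat \<Rightarrow> real" and \<beta> :: "'c \<Rightarrow> 'a \<Rightarrow> nat \<Rightarrow> real"
  assumes K: "simplicial_complex K" and C: "finite C"
    and suppK: "\<And>c. c \<in> C \<Longrightarrow> supp c \<in> K"
    and faces: "\<And>F. F \<in> K \<Longrightarrow> \<exists>c\<in>C. F \<subseteq> supp c"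
    and f: "\<And>v. v \<in> vertices K \<Longrightarrow> f v \<in> Eucl n"
    and dual: "\<And>c v w. c \<in> C \<Longrightarrow> v \<in> supp c \<Longrightarrow> w \<in> supp c \<Longrightarrow>
      (\<Sum>i<n. \<beta> c v i * f w i) = of_bool (v = w)"
    and span: "\<And>c i j. c \<in> C \<Longrightarrow> i < n \<Longrightarrow> j < n \<Longrightarrow>
      (\<Sum>v\<in>supp c. \<beta> c v j * f v i) = of_bool (i = j)"
    and strict: "\<And>c w. c \<in> C \<Longrightarrow> w \<in> vertices K - supp c \<Longrightarrow>
      (\<Sum>v\<in>supp c. \<Sum>i<n. \<beta> c v i * f w i) < 1"
    and neighbour: "\<And>c v. c \<in> C \<Longrightarrow> v \<in> supp c \<Longrightarrow>
      \<exists>c'\<in>C. v \<notin> supp c' \<and> supp c - {v} \<subseteq> supp c'"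
  shows "complete_fan n K f"
proof -
  define ip where "ip a x = (\<Sum>i<n. a i * x i)" for a x :: "nat \<Rightarrow> real"
  define l where "l c x = (\<Sum>v\<in>supp c. ip (\<beta> c v) x)" for c x
  let ?V = "vertices K" and ?comb = "vertex_comb K f"
  have finV: "finite ?V" by (rule finite_vertices[OF K])
  have suppV: "supp c \<subseteq> ?V" "finite (supp c)" if "c \<in> C" for c
    using suppK[OF that] K by (auto simp: vertices_def simplicial_complex_def)
  have ip_comb: "ip a (?comb t) = (\<Sum>v\<in>?V. t v * ip a (f v))" for a t
    unfolding ip_def vertex_comb_def sum_distrib_left
    by (subst sum.swap) (simp add: mult_ac)
  have l_comb: "l c (?comb t) = (\<Sum>v\<in>?V. t v * l c (f v))" for c t
    unfolding l_def ip_comb sum_distrib_left by (rule sum.swap)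
  have ip_dual: "ip (\<beta> c v) (f w) = of_bool (v = w)" if "c \<in> C" "v \<in> supp c" "w \<in> supp c" for c v w
    using dual[OF that] by (simp add: ip_def)
  have l_on: "l c (f w) = 1" if "c \<in> C" "w \<in> supp c" for c w
    unfolding l_def using that suppV[OF that(1)] by (simp add: ip_dual)
  have l_off: "l c (f w) < 1" if "c \<in> C" "w \<in> ?V" "w \<notin> supp c" for c w
    using strict[of c w] that by (simp add: l_def ip_def)
  have expand: "x = ?comb (\<lambda>v. if v \<in> supp c then ip (\<beta> c v) x else 0)"
    if c: "c \<in> C" and x: "x \<in> Eucl n" for c x
  proof
    fix i
    have "?comb (\<lambda>v. if v \<in> supp c then ip (\<beta> c v) x else 0) i
        = (\<Sum>v\<in>supp c. ip (\<beta> c v) x * f v i)"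
      unfolding vertex_comb_def using suppV[OF c] finV
      by (intro sum.mono_neutral_cong_right) auto
    also have "\<dots> = x i"
    proof (cases "i < n")
      case True
      have "(\<Sum>v\<in>supp c. ip (\<beta> c v) x * f v i) = (\<Sum>j<n. x j * (\<Sum>v\<in>supp c. \<beta> c v j * f v i))"
        unfolding ip_def sum_distrib_left sum_distrib_right by (subst sum.swap) (simp add: mult_ac)
      also have "\<dots> = x i" using True by (simp add: span[OF c])
      finally show ?thesis .
    next
      case False
      then have "f v i = 0" if "v \<in> supp c" for v
        using f suppV[OF c] that by (auto simp: Eucl_def)
      then show ?thesis using False x by (simp add: Eucl_def)
    qed
    finally show "x i = ?comb (\<lambda>v. if v \<in> supp c then ip (\<beta> c v) x else 0) i" by simp
  qed
  have comb_Eucl: "?comb t \<in> Eucl n" for t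
    unfolding Eucl_def vertex_comb_def using f
    by (intro CollectI allI impI sum.neutral ballI) (simp add: Eucl_def)
  have "\<exists>t\<in>conic_realization K. x = ?comb t" if x: "x \<in> Eucl n" for x
  proof -
    have "C \<noteq> {}" using faces[OF empty_in_complex[OF K]] by blast
    then obtain c where c: "c \<in> C" and max_eq: "l c x = Max ((\<lambda>c. l c x) ` C)"
      using obtains_MAX[OF C] by metis
    have max: "l d x \<le> l c x" if "d \<in> C" for d
      unfolding max_eq using C that by simp
    let ?t = "\<lambda>v. if v \<in> supp c then ip (\<beta> c v) x else 0"
    have xt: "x = ?comb ?t" by (rule expand[OF c x])
    have "0 \<le> ip (\<beta> c v) x" if v: "v \<in> supp c" for v
    proof (rule ccontr)
      assume neg: "\<not> 0 \<le> ip (\<beta> c v) x"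
      \<comment> \<open>Crossing to the facet opposite \<open>v\<close> would raise the functional:
        the new one is still 1 at the other vertices of \<open>supp c\<close> and below 1 at
        \<open>v\<close>, where the coefficient is negative.\<close>
      obtain d where d: "d \<in> C" "v \<notin> supp d" "supp c - {v} \<subseteq> supp d"
        using neighbour[OF c v] by blast
      have "l d x = (\<Sum>w\<in>?V. ?t w * l d (f w))"
        by (subst xt) (rule l_comb)
      also have "\<dots> = (\<Sum>w\<in>supp c. ip (\<beta> c w) x * l d (f w))"
        using suppV[OF c] finV by (intro sum.mono_neutral_cong_right) auto
      also have "\<dots> > (\<Sum>w\<in>supp c. ip (\<beta> c w) x)"
      proof (rule sum_strict_mono_ex1)
        have "ip (\<beta> c w) x = ip (\<beta> c w) x * l d (f w)" if "w \<in> supp c" "w \<noteq> v" for w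
          using l_on[OF d(1)] d that by auto
        moreover have less: "ip (\<beta> c v) x < ip (\<beta> c v) x * l d (f v)"
          using l_off[OF d(1) _ d(2)] suppV[OF c] v neg by (auto simp: subset_iff)
        ultimately show "\<forall>w\<in>supp c. ip (\<beta> c w) x \<le> ip (\<beta> c w) x * l d (f w)"
          by (metis order_le_less order_refl)
        show "\<exists>w\<in>supp c. ip (\<beta> c w) x < ip (\<beta> c w) x * l d (f w)" using less v by blast
      qed (use suppV[OF c] in simp)
      finally show False using max[OF d(1)] by (simp add: l_def)
    qed
    moreover have "{v. ?t v \<noteq> 0} \<in> K"
      by (rule face_subset[OF K suppK[OF c]]) auto
    ultimately have "?t \<in> conic_realization K" by (simp add: conic_realization_def)
    then show ?thesis using xt by blast
  qed
  moreover have "s = t"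
    if s: "s \<in> conic_realization K" and t: "t \<in> conic_realization K" and eq: "?comb s = ?comb t"
    for s t
  proof -
    \<comment> \<open>The functional of a facet carrying \<open>s\<close> evaluates to the
      coefficient sum of \<open>s\<close>, but to at most that of \<open>t\<close>. Both directions
      together give equal sums, and equality forces \<open>t\<close> onto the same facet.\<close>
    have le: "(\<Sum>v\<in>?V. s v) \<le> (\<Sum>v\<in>?V. t v) \<and>
        ((\<Sum>v\<in>?V. s v) = (\<Sum>v\<in>?V. t v) \<longrightarrow> (\<forall>v. v \<notin> supp c \<longrightarrow> t v = 0))"
      if s: "s \<in> conic_realization K" and t: "t \<in> conic_realization K"
        and eq: "?comb s = ?comb t" and c: "c \<in> C" "{v. s v \<noteq> 0} \<subseteq> supp c" for s t c
    proof -
      have term_le: "t v * l c (f v) \<le> t v" if "v \<in> ?V" for v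
        using l_on[OF c(1)] l_off[OF c(1) that] t
        by (cases "v \<in> supp c") (auto simp: conic_realization_def mult_left_le less_imp_le)
      have "(\<Sum>v\<in>?V. s v) = (\<Sum>v\<in>?V. s v * l c (f v))"
        using l_on[OF c(1)] c(2) by (intro sum.cong) (auto simp: subset_iff)
      also have "\<dots> = (\<Sum>v\<in>?V. t v * l c (f v))" using eq l_comb by metis
      finally have sum: "(\<Sum>v\<in>?V. s v) = (\<Sum>v\<in>?V. t v * l c (f v))" .
      moreover have "t v = 0" if "v \<notin> supp c" and "(\<Sum>v\<in>?V. s v) = (\<Sum>v\<in>?V. t v)" for v
      proof (rule ccontr)
        assume nz: "t v \<noteq> 0"
        then have vV: "v \<in> ?V" by (rule support_subset_vertices[OF t])
        have "(\<Sum>v\<in>?V. t v * l c (f v)) < (\<Sum>v\<in>?V. t v)"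
        proof (rule sum_strict_mono_ex1[OF finV])
          have "0 < t v" using t nz by (simp add: conic_realization_def less_le)
          then have "t v * l c (f v) < t v" using l_off[OF c(1) vV that(1)] by simp
          then show "\<exists>v\<in>?V. t v * l c (f v) < t v" using vV by blast
        qed (use term_le in blast)
        then show False using sum that(2) by simp
      qed
      ultimately show ?thesis using sum_mono[of ?V, OF term_le] by simp
    qed
    obtain c where c: "c \<in> C" "{v. s v \<noteq> 0} \<subseteq> supp c"
      using faces[of "{v. s v \<noteq> 0}"] s unfolding conic_realization_def by blast
    obtain d where d: "d \<in> C" "{v. t v \<noteq> 0} \<subseteq> supp d"
      using faces[of "{v. t v \<noteq> 0}"] t unfolding conic_realization_def by blast
    have "(\<Sum>v\<in>?V. s v) = (\<Sum>v\<in>?V. t v)"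
      using le[OF s t eq c] le[OF t s eq[symmetric] d] by linarith
    then have t0: "\<And>v. v \<notin> supp c \<Longrightarrow> t v = 0" using le[OF s t eq c] by blast
    \<comment> \<open>On a single facet the dual basis reads off the coefficients.\<close>
    have coord: "r v = ip (\<beta> c v) (?comb r)"
      if v: "v \<in> supp c" and r: "\<And>v. v \<notin> supp c \<Longrightarrow> r v = 0" for r v
    proof -
      have "r w * ip (\<beta> c v) (f w) = r w * of_bool (v = w)" for w
        using ip_dual[OF c(1) v] r by (cases "w \<in> supp c") auto
      then have "ip (\<beta> c v) (?comb r) = (\<Sum>w\<in>?V. r w * of_bool (v = w))"
        unfolding ip_comb by (rule sum.cong[OF refl])
      then show ?thesis using v suppV[OF c(1)] finV by (auto simp: subset_iff)
    qed
    show "s = t"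
    proof
      fix v
      show "s v = t v"
      proof (cases "v \<in> supp c")
        case True
        have "s v = ip (\<beta> c v) (?comb s)" using c(2) by (intro coord[OF True]) blast
        moreover have "t v = ip (\<beta> c v) (?comb t)" using t0 by (intro coord[OF True])
        ultimately show ?thesis using eq by simp
      next
        case False
        then show ?thesis using t0 c(2) by auto
      qed
    qed
  qed
  ultimately have "bij_betw ?comb (conic_realization K) (Eucl n)"
    unfolding bij_betw_def inj_on_def using comb_Eucl by blast
  then show ?thesis using K by (simp add: complete_fan_def)
qed

section \<open>Faces, vertices and fans of iterated joins\<close>

lemma mem_simplicial_join_labelled_copy:
  "F \<in> simplicial_join K (labelled_copy i L) \<longleftrightarrow> (\<exists>G\<in>K. \<exists>H\<in>L. F = G \<union> Pair i ` H)"
  by (auto simp: simplicial_join_def labelled_copy_def)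

text \<open>The preimage under \<open>Pair i\<close> is the layer of a face in copy
  \<open>i\<close>. This layerwise description replaces the recursion in the later
  arguments.\<close>

lemma mem_iterated_join:
  assumes K: "simplicial_complex K"
  shows "F \<in> iterated_join k K \<longleftrightarrow> fst ` F \<subseteq> {..k} \<and> (\<forall>i\<le>k. Pair i -` F \<in> K)"
proof (induction k arbitrary: F)
  case 0
  have "F = Pair 0 ` (Pair 0 -` F)" if "fst ` F \<subseteq> {0}" using that by force
  then have "F \<in> iterated_join 0 K" if "fst ` F \<subseteq> {0}" "Pair 0 -` F \<in> K"
    using that by (metis imageI iterated_join.simps(1) labelled_copy_def)
  moreover have "Pair 0 -` (Pair (0::nat) ` G) = G" for G :: "'a set" by auto
  ultimately show ?case by (auto simp: labelled_copy_def)
next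
  case (Suc k)
  show ?case
  proof
    assume "F \<in> iterated_join (Suc k) K"
    then obtain G H where GH: "G \<in> iterated_join k K" "H \<in> K" "F = G \<union> Pair (Suc k) ` H"
      by (auto simp: mem_simplicial_join_labelled_copy)
    then have G: "fst ` G \<subseteq> {..k}" "\<And>i. i \<le> k \<Longrightarrow> Pair i -` G \<in> K" using Suc by auto
    have "Pair (Suc k) -` F = H" using GH(3) G(1) by force
    moreover have "Pair i -` F = Pair i -` G" if "i \<le> k" for i using GH(3) that by auto
    ultimately show "fst ` F \<subseteq> {..Suc k} \<and> (\<forall>i\<le>Suc k. Pair i -` F \<in> K)"
      using GH G by (auto simp: le_Suc_eq)
  next
    assume F: "fst ` F \<subseteq> {..Suc k} \<and> (\<forall>i\<le>Suc k. Pair i -` F \<in> K)"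
    let ?G = "{p \<in> F. fst p \<le> k}"
    have "Pair i -` ?G = Pair i -` F" if "i \<le> k" for i using that by auto
    then have "?G \<in> iterated_join k K" using F by (auto simp: Suc)
    moreover have "F = ?G \<union> Pair (Suc k) ` (Pair (Suc k) -` F)"
      using F by (force simp: le_Suc_eq)
    moreover have "Pair (Suc k) -` F \<in> K" using F by blast
    ultimately show "F \<in> iterated_join (Suc k) K"
      unfolding iterated_join.simps mem_simplicial_join_labelled_copy by blast
  qed
qed

lemma vertices_iterated_join:
  assumes K: "simplicial_complex K"
  shows "vertices (iterated_join k K) = {..k} \<times> vertices K"
proof (intro subset_antisym subsetI)
  fix p assume "p \<in> vertices (iterated_join k K)"
  then obtain F where F: "F \<in> iterated_join k K" "p \<in> F" by (auto simp: vertices_def)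
  then have "fst p \<le> k" "Pair (fst p) -` F \<in> K" by (auto simp: mem_iterated_join[OF K])
  moreover have "snd p \<in> Pair (fst p) -` F" using F by simp
  ultimately show "p \<in> {..k} \<times> vertices K" by (cases p) (auto simp: vertices_def)
next
  fix p assume "p \<in> {..k} \<times> vertices K"
  then obtain i v where p: "p = (i, v)" "i \<le> k" "{v} \<in> K"
    using singleton_face[OF K] by auto
  moreover have "Pair j -` {p} = (if j = i then {v} else {})" for j using p by auto
  ultimately have "{p} \<in> iterated_join k K"
    using empty_in_complex[OF K] by (simp add: mem_iterated_join[OF K])
  then show "p \<in> vertices (iterated_join k K)" by (auto simp: vertices_def)
qed

lemma simplicial_complex_iterated_join:
  assumes K: "simplicial_complex K"
  shows "simplicial_complex (iterated_join k K)"
proof -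
  have "iterated_join k K \<subseteq> Pow ({..k} \<times> vertices K)"
    unfolding vertices_iterated_join[OF K, symmetric] by (auto simp: vertices_def)
  moreover have fin: "finite ({..k} \<times> vertices K)" using finite_vertices[OF K] by simp
  ultimately have "finite (iterated_join k K)" "\<forall>F\<in>iterated_join k K. finite F"
    by (meson finite_Pow_iff finite_subset, meson PowD finite_subset subsetD)
  moreover have "G \<in> iterated_join k K" if "F \<in> iterated_join k K" "G \<subseteq> F" for F G
  proof -
    have "Pair i -` G \<in> K" if "i \<le> k" for i
      using \<open>F \<in> _\<close> that face_subset[OF K _ vimage_mono[OF \<open>G \<subseteq> F\<close>]]
      by (simp add: mem_iterated_join[OF K])
    then show ?thesis using that by (auto simp: mem_iterated_join[OF K])
  qed
  moreover have "{} \<in> iterated_join k K"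
    using empty_in_complex[OF K] by (simp add: mem_iterated_join[OF K])
  ultimately show ?thesis unfolding simplicial_complex_def by blast
qed

text \<open>Copy \<open>i\<close> occupies the block of coordinates from \<open>n * i\<close> to
  \<open>n * i + n - 1\<close>. The ambient space is thus a direct sum of \<open>k + 1\<close>
  copies of R^n, and coordinates are found block by block.\<close>

theorem complete_fan_iterated_join:
  assumes fan: "complete_fan n K f" and n: "0 < n"
  shows "complete_fan (n * Suc k) (iterated_join k K)
    (\<lambda>p j. if j div n = fst p then f (snd p) (j mod n) else 0)"
proof -
  interpret complete_fan n K f by (rule fan)
  let ?D = "iterated_join k K"
  let ?comb = "vertex_comb ?D (\<lambda>p j. if j div n = fst p then f (snd p) (j mod n) else 0)"
  have bound: "j div n \<le> k \<longleftrightarrow> j < n * Suc k" for j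
    using n by (metis less_Suc_eq_le less_mult_imp_div_less mult.commute div_less_iff_less_mult)
  have conic: "t \<in> conic_realization ?D \<longleftrightarrow>
      (\<forall>i\<le>k. (\<lambda>v. t (i, v)) \<in> conic_realization K) \<and> (\<forall>i v. k < i \<longrightarrow> t (i, v) = 0)" for t
  proof -
    have "fst ` {p. t p \<noteq> 0} \<subseteq> {..k} \<longleftrightarrow> (\<forall>i v. k < i \<longrightarrow> t (i, v) = 0)"
      by (auto simp: image_subset_iff not_le[symmetric])
    moreover have "(\<forall>p. 0 \<le> t p) \<longleftrightarrow> (\<forall>i\<le>k. \<forall>v. 0 \<le> t (i, v))"
      if "\<forall>i v. k < i \<longrightarrow> t (i, v) = 0"
      using that by (auto simp: not_le[symmetric]) (metis order_refl)
    ultimately show ?thesis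
      unfolding conic_realization_def mem_Collect_eq mem_iterated_join[OF complex] vimage_def
      by blast
  qed
  have comb_eq: "?comb t j = (if j div n \<le> k then comb (\<lambda>v. t (j div n, v)) (j mod n) else 0)" for t j
  proof -
    have "?comb t j = (\<Sum>i\<le>k. \<Sum>v\<in>vertices K. t (i, v) * (if j div n = i then f v (j mod n) else 0))"
      unfolding vertex_comb_def vertices_iterated_join[OF complex]
      by (simp add: sum.cartesian_product case_prod_unfold)
    also have "\<dots> = (\<Sum>i\<le>k. if j div n = i then \<Sum>v\<in>vertices K. t (i, v) * f v (j mod n) else 0)"
      by (intro sum.cong) auto
    also have "\<dots> = (if j div n \<le> k then comb (\<lambda>v. t (j div n, v)) (j mod n) else 0)"
      by (simp add: vertex_comb_def)
    finally show ?thesis .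
  qed
  have "bij_betw ?comb (conic_realization ?D) (Eucl (n * Suc k))"
    unfolding bij_betw_def
  proof (intro conjI inj_onI subset_antisym subsetI)
    fix s t assume st: "s \<in> conic_realization ?D" "t \<in> conic_realization ?D" and eq: "?comb s = ?comb t"
    have "(\<lambda>v. s (i, v)) = (\<lambda>v. t (i, v))" if i: "i \<le> k" for i
    proof -
      have sK: "(\<lambda>v. s (i, v)) \<in> conic_realization K" "(\<lambda>v. t (i, v)) \<in> conic_realization K"
        using st i conic by blast+
      have "comb (\<lambda>v. s (i, v)) j = comb (\<lambda>v. t (i, v)) j" for j
      proof (cases "j < n")
        case True
        then have "(n * i + j) div n = i" "(n * i + j) mod n = j" by simp_all
        then show ?thesis using fun_cong[OF eq, of "n * i + j"] i by (simp add: comb_eq)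
      next
        case False
        then show ?thesis using comb_in_Eucl[OF sK(1)] comb_in_Eucl[OF sK(2)] by (simp add: Eucl_def)
      qed
      then show ?thesis using comb_eq_iff[OF sK] by blast
    qed
    moreover have "s (i, v) = t (i, v)" if "\<not> i \<le> k" for i v using st conic that by auto
    ultimately have "s (i, v) = t (i, v)" for i v by (metis (no_types))
    then show "s = t" by auto
  next
    fix x assume "x \<in> ?comb ` conic_realization ?D"
    then show "x \<in> Eucl (n * Suc k)" by (auto simp: Eucl_def comb_eq bound simp del: mult_Suc_right)
  next
    fix x assume x: "x \<in> Eucl (n * Suc k)"
    let ?y = "\<lambda>i j. if j < n then x (n * i + j) else 0"
    have "\<exists>t\<in>conic_realization K. comb t = ?y i" for i
    proof -
      have "?y i \<in> Eucl n" by (simp add: Eucl_def)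
      then show ?thesis using bij_betw_imp_surj_on[OF bij] by (metis (no_types, lifting) imageE)
    qed
    then obtain T where T: "\<And>i. T i \<in> conic_realization K" "\<And>i. comb (T i) = ?y i" by metis
    \<comment> \<open>\<open>T\<close> is chosen for every index, so the coordinates of copies
      beyond \<open>k\<close> have to be set to 0.\<close>
    let ?t = "\<lambda>p. if fst p \<le> k then T (fst p) (snd p) else 0"
    have "?t \<in> conic_realization ?D" using T(1) by (simp add: conic)
    moreover have "?comb ?t = x"
    proof
      fix j
      show "?comb ?t j = x j"
        using x n bound[of j] by (auto simp: comb_eq T(2) Eucl_def simp del: mult_Suc_right)
    qed
    ultimately show "x \<in> ?comb ` conic_realization ?D" by blast
  qed
  then show ?thesis using simplicial_complex_iterated_join[OF complex] by (simp add: complete_fan_def)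
qed

subsection \<open>Clique complexes\<close>

text \<open>Flagness as a condition on pairwise adjacency, a form that can be checked by enumeration
  and passes to joins layer by layer.\<close>

definition clique_complex :: "'a set set \<Rightarrow> bool" where
  "clique_complex K \<longleftrightarrow> simplicial_complex K \<and>
     (\<forall>F \<subseteq> vertices K. (\<forall>a\<in>F. \<forall>b\<in>F. {a, b} \<in> K) \<longrightarrow> F \<in> K)"

lemma face_pair: "simplicial_complex K \<Longrightarrow> F \<in> K \<Longrightarrow> a \<in> F \<Longrightarrow> b \<in> F \<Longrightarrow> {a, b} \<in> K"
  by (rule face_subset) auto

text \<open>A nonface contains a nonadjacent pair, and minimality leaves room for nothing
  else.\<close>

lemma flag_clique_complex:
  assumes "clique_complex K"
  shows "flag K"
  unfolding flag_def
proof (intro allI impI)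
  fix F assume F: "minimal_nonface K F"
  then obtain a b where ab: "a \<in> F" "b \<in> F" "{a, b} \<notin> K"
    using assms unfolding minimal_nonface_def clique_complex_def by meson
  have "F = {a, b}"
  proof (rule ccontr)
    assume "F \<noteq> {a, b}"
    then have "{a, b} \<subset> F" using ab by blast
    then show False using F ab(3) unfolding minimal_nonface_def by meson
  qed
  moreover have "a \<in> vertices K" using ab(1) F by (auto simp: minimal_nonface_def)
  then have "{a} \<in> K" using assms by (simp add: clique_complex_def singleton_face)
  then have "a \<noteq> b" using ab(3) by auto
  ultimately show "card F = 2" by simp
qed

lemma edge_iterated_join_same:
  assumes "simplicial_complex K"
  shows "{(i, a), (i, b)} \<in> iterated_join k K \<longleftrightarrow> i \<le> k \<and> {a, b} \<in> K"
proof -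
  have "Pair j -` {(i, a), (i, b)} = (if j = i then {a, b} else {})" for j by auto
  then show ?thesis
    using empty_in_complex[OF assms] by (auto simp: mem_iterated_join[OF assms])
qed

lemma edge_iterated_join_distinct:
  assumes "simplicial_complex K" "i \<noteq> j"
  shows "{(i, a), (j, b)} \<in> iterated_join k K \<longleftrightarrow>
    i \<le> k \<and> j \<le> k \<and> a \<in> vertices K \<and> b \<in> vertices K"
proof -
  have "Pair l -` {(i, a), (j, b)} = (if l = i then {a} else if l = j then {b} else {})" for l
    using assms(2) by auto
  moreover have "{v} \<in> K \<longleftrightarrow> v \<in> vertices K" for v
    using singleton_face[OF assms(1)] by (auto simp: vertices_def)
  ultimately show ?thesis
    using empty_in_complex[OF assms(1)] assms(2) by (auto simp: mem_iterated_join[OF assms(1)])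
qed

lemma clique_complex_iterated_join:
  assumes "clique_complex K"
  shows "clique_complex (iterated_join k K)"
proof -
  have K: "simplicial_complex K" using assms by (simp add: clique_complex_def)
  have "F \<in> iterated_join k K"
    if F: "F \<subseteq> vertices (iterated_join k K)" "\<forall>p\<in>F. \<forall>q\<in>F. {p, q} \<in> iterated_join k K" for F
  proof -
    have FV: "F \<subseteq> {..k} \<times> vertices K" using F(1) vertices_iterated_join[OF K] by blast
    have "Pair i -` F \<in> K" for i
    proof -
      have "{a, b} \<in> K" if "a \<in> Pair i -` F" "b \<in> Pair i -` F" for a b
        using F(2) that edge_iterated_join_same[OF K] by blast
      moreover have "Pair i -` F \<subseteq> vertices K" using FV by auto
      ultimately show ?thesis using assms by (simp add: clique_complex_def)
    qed
    then show ?thesis using FV by (auto simp: mem_iterated_join[OF K])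
  qed
  then show ?thesis
    using simplicial_complex_iterated_join[OF K] by (simp add: clique_complex_def)
qed

lemma image_complex_of_facets:
  "(`) f ` complex_of_facets S = complex_of_facets ((`) f ` S)"
proof (intro subset_antisym subsetI)
  fix F assume "F \<in> complex_of_facets ((`) f ` S)"
  then obtain G where G: "G \<in> S" "F \<subseteq> f ` G" by (auto simp: complex_of_facets_def)
  then obtain G' where "G' \<subseteq> G" "F = f ` G'" using subset_imageE by metis
  with G(1) show "F \<in> (`) f ` complex_of_facets S" by (auto simp: complex_of_facets_def)
next
  fix F assume "F \<in> (`) f ` complex_of_facets S"
  then show "F \<in> complex_of_facets ((`) f ` S)" by (auto simp: complex_of_facets_def)
qed

text \<open>With all sides present and both diagonals absent, each face misses an end of each
  diagonal and so lies in a side; the four vertices induce a 4-cycle.\<close>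

lemma edge_in_square_not_contractible:
  assumes K: "clique_complex K"
    and edges: "{a, b} \<in> K" "{b, c} \<in> K" "{c, d} \<in> K" "{d, a} \<in> K"
    and diagonals: "{a, c} \<notin> K" "{b, d} \<notin> K"
  shows "\<not> contractible_edge K {a, b}"
proof -
  let ?W = "{a, b, c, d}"
  let ?I = "induced_subcomplex K ?W"
  have sc: "simplicial_complex K" using K by (simp add: clique_complex_def)
  have W: "?W \<subseteq> vertices K" using edges by (auto simp: vertices_def)
  have dist: "distinct [a, b, c, d]"
    using edges diagonals singleton_face[OF sc] W by (auto simp: insert_commute)
  have I: "?I = complex_of_facets {{a, b}, {b, c}, {c, d}, {d, a}}" (is "_ = ?C")
  proof (intro subset_antisym subsetI)
    fix G assume "G \<in> ?I"
    then have G: "G \<in> K" "G \<subseteq> ?W" by (auto simp: induced_subcomplex_def)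
    have "a \<notin> G \<or> c \<notin> G" "b \<notin> G \<or> d \<notin> G"
      using face_pair[OF sc G(1), of a c] face_pair[OF sc G(1), of b d] diagonals by metis+
    then have "G \<subseteq> {a, b} \<or> G \<subseteq> {b, c} \<or> G \<subseteq> {c, d} \<or> G \<subseteq> {d, a}"
    proof (elim disjE)
      assume "a \<notin> G" "b \<notin> G"
      then have "G \<subseteq> {c, d}" using G(2) by blast
      then show ?thesis by simp
    next
      assume "a \<notin> G" "d \<notin> G"
      then have "G \<subseteq> {b, c}" using G(2) by blast
      then show ?thesis by simp
    next
      assume "c \<notin> G" "b \<notin> G"
      then have "G \<subseteq> {d, a}" using G(2) by blast
      then show ?thesis by simp
    next
      assume "c \<notin> G" "d \<notin> G"
      then have "G \<subseteq> {a, b}" using G(2) by blast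
      then show ?thesis by simp
    qed
    then show "G \<in> ?C" by (simp add: complex_of_facets_def)
  next
    fix G assume "G \<in> ?C"
    then obtain e where "e \<in> {{a, b}, {b, c}, {c, d}, {d, a}}" "G \<subseteq> e"
      by (auto simp: complex_of_facets_def)
    moreover from this have "e \<in> K" "e \<subseteq> ?W" using edges by auto
    ultimately show "G \<in> ?I" using face_subset[OF sc] by (auto simp: induced_subcomplex_def)
  qed
  define f where "f v = (if v = a then 0 else if v = b then 1 else if v = c then 2 else 3 :: nat)" for v
  have f: "f a = 0" "f b = 1" "f c = 2" "f d = 3" using dist by (auto simp: f_def)
  have vI: "vertices ?I = ?W" unfolding I by (auto simp: vertices_def complex_of_facets_def)
  have vC: "vertices four_cycle = {0, 1, 2, 3}"
    by (auto simp: vertices_def four_cycle_def complex_of_facets_def)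
  have "bij_betw f ?W {0, 1, 2, 3}"
    using f by (auto simp: bij_betw_def)
  then have "bij_betw f (vertices ?I) (vertices four_cycle)" unfolding vI vC .
  moreover have "(`) f ` {{a, b}, {b, c}, {c, d}, {d, a}} = {{0, 1}, {1, 2}, {2, 3}, {3, 0}}"
    by (simp add: f)
  then have "(`) f ` ?I = four_cycle"
    unfolding I image_complex_of_facets four_cycle_def by (rule arg_cong)
  ultimately have "isomorphic_complexes ?I four_cycle"
    unfolding isomorphic_complexes_def by blast
  moreover have "{a, b} \<in> ?I" using edges by (simp add: induced_subcomplex_def)
  ultimately show ?thesis using W unfolding contractible_edge_def by blast
qed

text \<open>An apex of a suspension is adjacent to every vertex except the other apex, so it has
  only one nonneighbour.\<close>

lemma two_nonneighbours_not_suspension: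
  assumes "\<And>v. v \<in> vertices K \<Longrightarrow> \<exists>a\<in>vertices K. \<exists>b\<in>vertices K.
      a \<noteq> b \<and> a \<noteq> v \<and> b \<noteq> v \<and> {v, a} \<notin> K \<and> {v, b} \<notin> K"
  shows "\<not> is_suspension K"
proof
  assume "is_suspension K"
  then obtain L v w where L: "simplicial_complex L"
    and K: "K = simplicial_join L (complex_of_facets {{v}, {w}})"
    by (auto simp: is_suspension_def)
  have mem: "F \<union> G \<in> K" if "F \<in> L" "G \<subseteq> {v} \<or> G \<subseteq> {w}" for F G
    using that by (auto simp: K simplicial_join_def complex_of_facets_def)
  have adjacent: "{v, x} \<in> K" if x: "x \<in> vertices K" "x \<noteq> v" "x \<noteq> w" for x
  proof -
    obtain F G where "F \<in> L" "G \<subseteq> {v} \<or> G \<subseteq> {w}" "x \<in> F \<union> G"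
      using x(1) by (auto simp: K simplicial_join_def complex_of_facets_def vertices_def)
    then have "{x} \<in> L" using x face_subset[OF L, of F "{x}"] by auto
    then show ?thesis using mem[of "{x}" "{v}"] by (simp add: insert_commute)
  qed
  have "v \<in> vertices K"
    using mem[OF empty_in_complex[OF L], of "{v}"] by (auto simp: vertices_def)
  then obtain a b where "a \<in> vertices K" "b \<in> vertices K" "a \<noteq> b" "a \<noteq> v" "b \<noteq> v"
      "{v, a} \<notin> K" "{v, b} \<notin> K"
    using assms by blast
  then show False using adjacent by metis
qed

text \<open>In a clique complex, a face consisting of neighbours of \<open>v\<close> remains a face
  when \<open>v\<close> is added.\<close>

lemma induced_neighbourhood_eq_link:
  assumes K: "clique_complex K" and v: "v \<in> vertices K"
    and W: "W \<subseteq> vertices K" "\<And>w. w \<in> vertices K \<Longrightarrow> w \<in> W \<longleftrightarrow> w \<noteq> v \<and> {v, w} \<in> K"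
  shows "induced_subcomplex K W = face_link K {v}"
proof (intro subset_antisym subsetI)
  have sc: "simplicial_complex K" using K by (simp add: clique_complex_def)
  fix G
  {
    assume "G \<in> induced_subcomplex K W"
    then have G: "G \<in> K" "G \<subseteq> W" by (auto simp: induced_subcomplex_def)
    have GV: "G \<subseteq> vertices K" using G(1) by (auto simp: vertices_def)
    have nb: "g \<noteq> v \<and> {v, g} \<in> K" if "g \<in> G" for g using that G(2) GV W(2) by blast
    have "{x, y} \<in> K" if "x \<in> insert v G" "y \<in> insert v G" for x y
      using that nb face_pair[OF sc G(1)] singleton_face[OF sc v]
      by (metis doubleton_eq_iff insertE insert_absorb2)
    then have "insert v G \<in> K" using K GV v by (simp add: clique_complex_def)
    then show "G \<in> face_link K {v}" using G(1) nb by (auto simp: face_link_def)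
  next
    assume "G \<in> face_link K {v}"
    then have G: "G \<in> K" "insert v G \<in> K" "v \<notin> G" by (auto simp: face_link_def)
    have "g \<in> W" if "g \<in> G" for g
    proof -
      have "{v, g} \<in> K" using face_pair[OF sc G(2)] that by blast
      moreover have "g \<in> vertices K" using that G(1) by (auto simp: vertices_def)
      ultimately show ?thesis using W(2) that G(3) by blast
    qed
    then show "G \<in> induced_subcomplex K W" using G(1) by (auto simp: induced_subcomplex_def)
  }
qed

subsection \<open>The complex with 12 vertices and 33 facets\<close>

text \<open>Up to rotating and rounding the first complex coordinate these are the points
  \<open>(\<zeta>\<^sup>m, \<omega>\<^sup>m)\<close>, \<open>m < 9\<close>, and \<open>(0, -\<omega>\<^sup>m)\<close>, \<open>m < 3\<close>, where \<open>\<zeta>\<close> and \<open>\<omega>\<close> are primitive ninth and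
  third roots of unity; the second complex coordinate is written in the basis \<open>1, \<omega>\<close>. This
  configuration has the cyclic symmetry of order 9 of the complex.\<close>

fun coords :: "vertex12 \<Rightarrow> int list" where
  "coords X1 = [1, 0, 1, 0]"
| "coords X2 = [-1, 1, 1, 0]"
| "coords X3 = [0, -1, 1, 0]"
| "coords Y1 = [-1, 0, 0, 1]"
| "coords Y2 = [0, -1, 0, 1]"
| "coords Y3 = [1, 1, 0, 1]"
| "coords Z1 = [1, 0, -1, -1]"
| "coords Z2 = [0, 1, -1, -1]"
| "coords Z3 = [-1, -1, -1, -1]"
| "coords V1 = [0, 0, 1, 1]"
| "coords V2 = [0, 0, -1, 0]"
| "coords V3 = [0, 0, 0, -1]"

text \<open>The complement of the edge graph governs everything asked of the complex: faces are its
  independent sets, diagonals of induced squares are among its edges, and two sides of an equator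
  are completely joined in it.\<close>

fun nonneighbours :: "vertex12 \<Rightarrow> vertex12 list" where
  "nonneighbours X1 = [Y1, Z3, V2]"
| "nonneighbours X2 = [Y2, Z1, V2]"
| "nonneighbours X3 = [Y3, Z2, V2]"
| "nonneighbours Y1 = [X1, Z1, V3]"
| "nonneighbours Y2 = [X2, Z2, V3]"
| "nonneighbours Y3 = [X3, Z3, V3]"
| "nonneighbours Z1 = [X2, Y1, V1]"
| "nonneighbours Z2 = [X3, Y2, V1]"
| "nonneighbours Z3 = [X1, Y3, V1]"
| "nonneighbours V1 = [Z1, Z2, Z3, V2, V3]"
| "nonneighbours V2 = [X1, X2, X3, V1, V3]"
| "nonneighbours V3 = [Y1, Y2, Y3, V1, V2]"

text \<open>Each vertex of a facet comes with its dual coordinate functional relative to \<open>coords\<close>, scaled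
  by 60 to be integral.\<close>

definition facet_data :: "(vertex12 \<times> int list) list list" where
  "facet_data = [
    [(X1, [40, 20, 20, -20]), (X2, [-20, 20, 20, -20]), (X3, [-20, -40, 20, -20]), (V1, [0, 0, 0, 60])],
    [(X1, [30, 0, 30, -30]), (X2, [-15, 30, 15, -15]), (Y3, [15, 30, -15, 15]), (V1, [-15, -30, 15, 45])],
    [(X1, [60, 0, 0, 0]), (X3, [-30, -30, 30, -30]), (Y2, [30, -30, -30, 30]), (V1, [-30, 30, 30, 30])],
    [(X1, [40, -20, 20, -20]), (Y2, [20, -40, -20, 20]), (Y3, [20, 20, -20, 20]), (V1, [-40, 20, 40, 20])],
    [(X2, [-20, 20, 20, -20]), (X3, [-20, -40, 20, -20]), (Y1, [-40, -20, -20, 20]), (V1, [40, 20, 20, 40])],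
    [(X2, [-15, 30, 15, -15]), (Y1, [-30, 0, -30, 30]), (Y3, [15, 30, -15, 15]), (V1, [15, -30, 45, 15])],
    [(X3, [-30, -30, 30, -30]), (Y1, [-60, 0, 0, 0]), (Y2, [30, -30, -30, 30]), (V1, [30, 30, 30, 30])],
    [(Y1, [-40, 20, -20, 20]), (Y2, [20, -40, -20, 20]), (Y3, [20, 20, -20, 20]), (V1, [0, 0, 60, 0])],
    [(Y1, [-40, 20, 0, 20]), (Y2, [20, -40, 0, 20]), (Y3, [20, 20, 0, 20]), (V2, [0, 0, -60, 0])],
    [(Y1, [-40, 20, 0, 20]), (Y2, [20, -40, 0, 20]), (Z3, [-20, -20, 0, -20]), (V2, [20, 20, -60, 20])],
    [(Y1, [-40, 20, 0, 20]), (Y3, [20, 20, 0, 20]), (Z2, [-20, 40, 0, -20]), (V2, [20, -40, -60, 20])],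
    [(Y1, [-40, 20, 0, 20]), (Z2, [-20, 40, 0, -20]), (Z3, [-20, -20, 0, -20]), (V2, [40, -20, -60, 40])],
    [(Y2, [20, -40, 0, 20]), (Y3, [20, 20, 0, 20]), (Z1, [40, -20, 0, -20]), (V2, [-40, 20, -60, 20])],
    [(Y2, [20, -40, 0, 20]), (Z1, [40, -20, 0, -20]), (Z3, [-20, -20, 0, -20]), (V2, [-20, 40, -60, 40])],
    [(Y3, [20, 20, 0, 20]), (Z1, [40, -20, 0, -20]), (Z2, [-20, 40, 0, -20]), (V2, [-20, -20, -60, 40])],
    [(Z1, [40, -20, 0, -20]), (Z2, [-20, 40, 0, -20]), (Z3, [-20, -20, 0, -20]), (V2, [0, 0, -60, 60])],
    [(X1, [40, 20, 20, 0]), (X2, [-20, 20, 20, 0]), (X3, [-20, -40, 20, 0]), (V3, [0, 0, 0, -60])],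
    [(X1, [40, 20, 20, 0]), (X2, [-20, 20, 20, 0]), (Z2, [20, 40, -20, 0]), (V3, [-20, -40, 20, -60])],
    [(X1, [30, 30, 30, 0]), (X3, [0, -60, 0, 0]), (Z1, [30, -30, -30, 0]), (V3, [-30, 30, 30, -60])],
    [(X1, [30, 30, 30, 0]), (Z1, [30, -30, -30, 0]), (Z2, [0, 60, 0, 0]), (V3, [-30, -30, 30, -60])],
    [(X2, [-30, 15, 15, 0]), (X3, [0, -30, 30, 0]), (Z3, [-30, -15, -15, 0]), (V3, [30, 15, 15, -60])],
    [(X2, [-30, 15, 15, 0]), (Z2, [0, 30, -30, 0]), (Z3, [-30, -15, -15, 0]), (V3, [30, -15, 45, -60])],
    [(X3, [20, -40, 20, 0]), (Z1, [40, -20, -20, 0]), (Z3, [-20, -20, -20, 0]), (V3, [-20, 40, 40, -60])],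
    [(Z1, [40, -20, -20, 0]), (Z2, [-20, 40, -20, 0]), (Z3, [-20, -20, -20, 0]), (V3, [0, 0, 60, -60])],
    [(X1, [30, 0, 30, -30]), (X2, [-20, 20, 20, 0]), (Y3, [10, 20, -10, 30]), (Z2, [10, 20, -10, -30])],
    [(X2, [-10, 20, 30, -10]), (Y1, [-30, 0, -30, 30]), (Y3, [20, 20, 0, 20]), (Z2, [-10, 20, -30, -10])],
    [(X2, [-20, 10, 30, -20]), (Y1, [-20, 10, -30, 40]), (Z2, [0, 30, -30, 0]), (Z3, [-20, -20, 0, -20])],
    [(X2, [-20, 20, 20, -20]), (X3, [0, -30, 30, 0]), (Y1, [-20, -10, -10, 40]), (Z3, [-20, -10, -10, -20])],
    [(X3, [-15, -15, 45, -15]), (Y1, [-45, 15, 15, 15]), (Y2, [30, -30, -30, 30]), (Z3, [-15, -15, -15, -15])],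
    [(X3, [12, -24, 36, -24]), (Y2, [12, -24, -24, 36]), (Z1, [36, -12, -12, -12]), (Z3, [-24, -12, -12, -12])],
    [(X1, [40, 20, 20, 20]), (X3, [-20, -40, 20, -40]), (Y2, [20, -20, -20, 40]), (Z1, [20, -20, -20, -20])],
    [(X1, [24, -12, 36, -12]), (Y2, [12, -36, -12, 24]), (Y3, [12, 24, -12, 24]), (Z1, [24, -12, -24, -12])],
    [(X1, [15, 15, 45, -30]), (Y3, [15, 15, -15, 30]), (Z1, [30, -30, -30, 0]), (Z2, [-15, 45, 15, -30])]]"

definition facet :: "(vertex12 \<times> int list) list \<Rightarrow> vertex12 set" where
  "facet e = fst ` set e"

definition dual_coord :: "(vertex12 \<times> int list) list \<Rightarrow> vertex12 \<Rightarrow> nat \<Rightarrow> int" where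
  "dual_coord e v i = the (map_of e v) ! i"

definition all_vertices :: "vertex12 list" where
  "all_vertices = [X1, X2, X3, Y1, Y2, Y3, Z1, Z2, Z3, V1, V2, V3]"

lemma in_all_vertices: "v \<in> set all_vertices"
  by (cases v) (simp_all add: all_vertices_def)

lemma join_complex_of_facets:
  "simplicial_join (complex_of_facets A) (complex_of_facets B)
    = complex_of_facets ((\<lambda>(F, G). F \<union> G) ` (A \<times> B))"
proof -
  show ?thesis
  proof (intro subset_antisym subsetI)
    fix X assume "X \<in> complex_of_facets ((\<lambda>(F, G). F \<union> G) ` (A \<times> B))"
    then obtain F G where FG: "F \<in> A" "G \<in> B" "X \<subseteq> F \<union> G" by (auto simp: complex_of_facets_def)
    then have "X = (X \<inter> F) \<union> (X \<inter> G)" by blast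
    moreover have "X \<inter> F \<in> complex_of_facets A" "X \<inter> G \<in> complex_of_facets B"
      using FG by (auto simp: complex_of_facets_def)
    ultimately show "X \<in> simplicial_join (complex_of_facets A) (complex_of_facets B)"
      unfolding simplicial_join_def by blast
  next
    fix X assume "X \<in> simplicial_join (complex_of_facets A) (complex_of_facets B)"
    then obtain F G F' G' where "F \<in> A" "G \<in> B" "X = F' \<union> G'" "F' \<subseteq> F" "G' \<subseteq> G"
      by (auto simp: simplicial_join_def complex_of_facets_def)
    then show "X \<in> complex_of_facets ((\<lambda>(F, G). F \<union> G) ` (A \<times> B))"
      unfolding complex_of_facets_def by (auto intro!: bexI[of _ "(F, G)"])
  qed
qed

lemma Un_complex_of_facets:
  "complex_of_facets A \<union> complex_of_facets B = complex_of_facets (A \<union> B)"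
  by (auto simp: complex_of_facets_def)

text \<open>The local \<open>s\<close> and \<open>d\<close> redo joins and diamonds on finite
  generating sets, where equality with the tabulated facets is decided by evaluation.\<close>

lemma facet_data_eq:
  "((let s = \<lambda>p q. (\<lambda>(F, G). F \<union> G) ` (p \<times> q);
       d = \<lambda>(p1, p2, p3) (q1, q2, q3). s (s {{p1}, {q1}} {{p2}, {q2}}) {{p3}, {q3}}
    in s (d (X1, X2, X3) (Y1, Y2, Y3)) {{V1}} \<union> s (d (Y1, Y2, Y3) (Z1, Z2, Z3)) {{V2}}
      \<union> s (d (X1, X2, X3) (Z3, Z1, Z2)) {{V3}}
      \<union> {{X1, X2, Y3, Z2}, {X2, Y1, Y3, Z2}, {X2, Y1, Z2, Z3},
      {X2, X3, Y1, Z3}, {X3, Y1, Y2, Z3}, {X3, Y2, Z1, Z3},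
      {X1, X3, Y2, Z1}, {X1, Y2, Y3, Z1}, {X1, Y3, Z1, Z2}})
    = facet ` set facet_data)"
  by code_simp

text \<open>This and the next three evaluations are the hypotheses of
  \<open>complete_fan_of_convex_polytope\<close>, with the numerical ones multiplied by 60 to stay
  in the integers.\<close>

lemma dual_coord_on_facet:
  "\<forall>e\<in>set facet_data. \<forall>v\<in>facet e. \<forall>w\<in>facet e.
    (\<Sum>i<4. dual_coord e v i * coords w ! i) = (if v = w then 60 else 0)"
  by code_simp

lemma dual_coord_span:
  "\<forall>e\<in>set facet_data. \<forall>i\<in>{..<4}. \<forall>j\<in>{..<4}.
    (\<Sum>v\<in>facet e. dual_coord e v j * coords v ! i) = (if i = j then 60 else 0)"
  by code_simp

lemma dual_coord_off_facet:
  "\<forall>e\<in>set facet_data. \<forall>w\<in>set all_vertices. w \<notin> facet e \<longrightarrow>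
    (\<Sum>v\<in>facet e. \<Sum>i<4. dual_coord e v i * coords w ! i) < 60"
  by code_simp

lemma facet_neighbour:
  "\<forall>e\<in>set facet_data. \<forall>v\<in>facet e.
    \<exists>e'\<in>set facet_data. v \<notin> facet e' \<and> facet e - {v} \<subseteq> facet e'"
  by code_simp

text \<open>Building the sets vertex by vertex discards incompatible ones early, instead of testing
  every subset of the twelve vertices.\<close>

fun cliques :: "('a \<Rightarrow> 'a list) \<Rightarrow> 'a list \<Rightarrow> 'a list list" where
  "cliques N [] = [[]]"
| "cliques N (v # vs) = cliques N vs @
    map ((#) v) (filter (\<lambda>xs. \<forall>x\<in>set xs. x \<notin> set (N v)) (cliques N vs))"

lemma cliques_complete:
  "F \<subseteq> set vs \<Longrightarrow> \<forall>a\<in>F. \<forall>b\<in>F. b \<notin> set (N a) \<Longrightarrow> \<exists>xs\<in>set (cliques N vs). set xs = F"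
proof (induction vs arbitrary: F)
  case (Cons v vs)
  have "F - {v} \<subseteq> set vs" using Cons.prems by auto
  then obtain xs where xs: "xs \<in> set (cliques N vs)" "set xs = F - {v}"
    using Cons.IH[of "F - {v}"] Cons.prems(2) by blast
  show ?case
  proof (cases "v \<in> F")
    case True
    then show ?thesis
      using xs Cons.prems(2) by (intro bexI[of _ "v # xs"]) auto
  next
    case False
    then show ?thesis using xs by (intro bexI[of _ xs]) auto
  qed
qed auto

lemma cliques_in_facets: "\<forall>xs\<in>set (cliques nonneighbours all_vertices). \<exists>e\<in>set facet_data. set xs \<subseteq> facet e"
  by code_simp

text \<open>The first half, with \<open>cliques_in_facets\<close>, identifies faces with cliques;
  the second, maximality of the facets, gives the final contradiction for equators.\<close>

lemma facet_maximal_clique: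
  "\<forall>e\<in>set facet_data. (\<forall>a\<in>facet e. \<forall>b\<in>facet e. b \<notin> set (nonneighbours a)) \<and>
    (\<forall>c\<in>set all_vertices. c \<notin> facet e \<longrightarrow> (\<exists>g\<in>facet e. g \<in> set (nonneighbours c)))"
  by code_simp

lemma nonneighbours_properties:
  "\<forall>a\<in>set all_vertices. a \<notin> set (nonneighbours a) \<and> 2 \<le> card (set (nonneighbours a)) \<and>
    (\<forall>b\<in>set (nonneighbours a). a \<in> set (nonneighbours b))"
  by code_simp

text \<open>The square is \<open>a\<close>, \<open>b\<close>, \<open>c\<close>, \<open>d\<close> in
  cyclic order, with \<open>c\<close> opposite \<open>a\<close> and \<open>d\<close> opposite
  \<open>b\<close>.\<close>

lemma edge_in_square:
  "\<forall>a\<in>set all_vertices. \<forall>b\<in>set all_vertices. a \<noteq> b \<and> b \<notin> set (nonneighbours a) \<longrightarrow>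
    (\<exists>c\<in>set (nonneighbours a). \<exists>d\<in>set (nonneighbours b).
      c \<notin> set (nonneighbours b) \<and> d \<notin> set (nonneighbours a) \<and> d \<notin> set (nonneighbours c))"
  by code_simp

text \<open>Here \<open>a\<close>, \<open>a'\<close> stand for two vertices on one side of an
  equator and \<open>b\<close>, \<open>b'\<close> for two on the other. Each side lies in the common
  nonneighbours of the pair from the other side, so a facet avoiding both sets of common
  nonneighbours avoids both sides.\<close>

lemma facet_avoiding_biclique:
  "\<forall>a\<in>set all_vertices. \<forall>b\<in>set (nonneighbours a). \<forall>b'\<in>set (nonneighbours a).
    \<forall>a'\<in>set (nonneighbours b). a \<noteq> a' \<and> b \<noteq> b' \<and> a' \<in> set (nonneighbours b') \<longrightarrow>
      (\<exists>e\<in>set facet_data. \<forall>g\<in>facet e.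
        (g \<notin> set (nonneighbours a) \<or> g \<notin> set (nonneighbours a')) \<and>
        (g \<notin> set (nonneighbours b) \<or> g \<notin> set (nonneighbours b')))"
  by code_simp

section \<open>Faces and fan of \<open>Delta_12_33\<close>\<close>

lemma Delta_eq: "Delta_12_33 = complex_of_facets (facet ` set facet_data)"
  unfolding facet_data_eq[symmetric]
  by (simp only: Delta_12_33_def Gamma1_def Gamma2_def cone_def Let_def diamond.simps prod.case
      join_complex_of_facets Un_complex_of_facets)

lemma Delta_mem: "F \<in> Delta_12_33 \<longleftrightarrow> (\<exists>e\<in>set facet_data. F \<subseteq> facet e)"
  by (simp add: Delta_eq complex_of_facets_def)

lemma Delta_iff: "F \<in> Delta_12_33 \<longleftrightarrow> (\<forall>a\<in>F. \<forall>b\<in>F. b \<notin> set (nonneighbours a))"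
proof
  assume "F \<in> Delta_12_33"
  then obtain e where "e \<in> set facet_data" "F \<subseteq> facet e" by (auto simp: Delta_mem)
  then show "\<forall>a\<in>F. \<forall>b\<in>F. b \<notin> set (nonneighbours a)"
    using facet_maximal_clique by (meson subsetD)
next
  assume "\<forall>a\<in>F. \<forall>b\<in>F. b \<notin> set (nonneighbours a)"
  moreover have "F \<subseteq> set all_vertices" using in_all_vertices by blast
  ultimately obtain xs where "xs \<in> set (cliques nonneighbours all_vertices)" "set xs = F"
    using cliques_complete by meson
  then show "F \<in> Delta_12_33" using cliques_in_facets by (auto simp: Delta_mem)
qed

lemma nonneighbours_irrefl: "a \<notin> set (nonneighbours a)"
  using nonneighbours_properties in_all_vertices by blast

lemma nonneighbours_sym: "b \<in> set (nonneighbours a) \<Longrightarrow> a \<in> set (nonneighbours b)"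
  using nonneighbours_properties in_all_vertices by blast

lemma Delta_edge: "{a, b} \<in> Delta_12_33 \<longleftrightarrow> b \<notin> set (nonneighbours a)"
  using nonneighbours_irrefl nonneighbours_sym by (auto simp: Delta_iff)

lemma vertices_Delta: "vertices Delta_12_33 = UNIV"
proof -
  have "{v} \<in> Delta_12_33" for v by (simp add: Delta_iff nonneighbours_irrefl)
  then show ?thesis by (auto simp: vertices_def)
qed

lemma finite_UNIV_vertex12: "finite (UNIV :: vertex12 set)"
  using in_all_vertices by (intro finite_subset[OF _ finite_set[of all_vertices]]) blast

lemma clique_complex_Delta: "clique_complex Delta_12_33"
proof -
  have "simplicial_complex Delta_12_33"
    unfolding simplicial_complex_def
  proof (intro conjI ballI allI impI)
    have "Delta_12_33 \<subseteq> Pow UNIV" by simp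
    then show "finite Delta_12_33"
      using finite_UNIV_vertex12 by (meson finite_Pow_iff finite_subset)
    show "finite F" for F :: "vertex12 set"
      by (rule finite_subset[OF subset_UNIV finite_UNIV_vertex12])
    show "{} \<in> Delta_12_33" by (simp add: Delta_iff)
    show "G \<in> Delta_12_33" if "F \<in> Delta_12_33" "G \<subseteq> F" for F G
      using that by (auto simp: Delta_iff)
  qed
  then show ?thesis by (simp add: clique_complex_def Delta_edge Delta_iff)
qed

lemmas complex_Delta = clique_complex_Delta[unfolded clique_complex_def, THEN conjunct1]

definition real_coords :: "vertex12 \<Rightarrow> nat \<Rightarrow> real" where
  "real_coords v i = (if i < 4 then of_int (coords v ! i) else 0)"

lemma complete_fan_Delta: "complete_fan 4 Delta_12_33 real_coords"
proof -
  \<comment> \<open>Division by 60 undoes the scaling of the tabulated functionals.\<close>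
  define \<beta> where "\<beta> e v i = real_of_int (dual_coord e v i) / 60" for e v i
  have pairing: "(\<Sum>i<4. \<beta> e v i * real_coords w i)
      = real_of_int (\<Sum>i<4. dual_coord e v i * coords w ! i) / 60" for e v w
    unfolding of_int_sum sum_divide_distrib
    by (intro sum.cong) (simp_all add: \<beta>_def real_coords_def)
  show ?thesis
  proof (rule complete_fan_of_convex_polytope[where C = "set facet_data" and supp = facet and \<beta> = \<beta>])
    show "simplicial_complex Delta_12_33" by (rule complex_Delta)
    show "facet e \<in> Delta_12_33" if "e \<in> set facet_data" for e
      using that by (auto simp: Delta_mem)
    show "\<exists>e\<in>set facet_data. F \<subseteq> facet e" if "F \<in> Delta_12_33" for F
      using that by (simp add: Delta_mem)
    show "real_coords v \<in> Eucl 4" for v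
      by (simp add: Eucl_def real_coords_def)
    show "(\<Sum>i<4. \<beta> e v i * real_coords w i) = of_bool (v = w)"
      if "e \<in> set facet_data" "v \<in> facet e" "w \<in> facet e" for e v w
      unfolding pairing using dual_coord_on_facet that by simp
    show "(\<Sum>v\<in>facet e. \<beta> e v j * real_coords v i) = of_bool (i = j)"
      if "e \<in> set facet_data" "i < 4" "j < 4" for e i j
    proof -
      have "(\<Sum>v\<in>facet e. \<beta> e v j * real_coords v i)
          = real_of_int (\<Sum>v\<in>facet e. dual_coord e v j * coords v ! i) / 60"
        unfolding of_int_sum sum_divide_distrib using that
        by (intro sum.cong) (simp_all add: \<beta>_def real_coords_def)
      also have "(\<Sum>v\<in>facet e. dual_coord e v j * coords v ! i) = (if i = j then 60 else 0)"
        using dual_coord_span that by blast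
      finally show ?thesis by (cases "i = j") simp_all
    qed
    show "(\<Sum>v\<in>facet e. \<Sum>i<4. \<beta> e v i * real_coords w i) < 1"
      if "e \<in> set facet_data" "w \<in> vertices Delta_12_33 - facet e" for e w
    proof -
      have "(\<Sum>v\<in>facet e. \<Sum>i<4. dual_coord e v i * coords w ! i) < 60"
        using dual_coord_off_facet that in_all_vertices by blast
      then have "real_of_int (\<Sum>v\<in>facet e. \<Sum>i<4. dual_coord e v i * coords w ! i) < 60"
        by linarith
      then show ?thesis unfolding pairing by (simp flip: sum_divide_distrib)
    qed
    show "\<exists>e'\<in>set facet_data. v \<notin> facet e' \<and> facet e - {v} \<subseteq> facet e'"
      if "e \<in> set facet_data" "v \<in> facet e" for e v
      using facet_neighbour that by blast
  qed simp
qed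

section \<open>Edges, suspensions and equators of the iterated join\<close>

lemma edge_Delta_join:
  "{p, q} \<in> iterated_join k Delta_12_33 \<longleftrightarrow>
    fst p \<le> k \<and> fst q \<le> k \<and> (fst p = fst q \<longrightarrow> snd q \<notin> set (nonneighbours (snd p)))"
  using edge_iterated_join_same[OF complex_Delta] edge_iterated_join_distinct[OF complex_Delta]
  by (cases p; cases q; cases "fst p = fst q") (auto simp: Delta_edge vertices_Delta)

text \<open>The opposite corners of a square through the edge are a nonneighbour of \<open>a\<close>
  in copy \<open>i\<close> and one of \<open>b\<close> in copy \<open>j\<close>. Across different
  copies the other sides exist automatically; within one copy \<open>edge_in_square\<close> supplies
  them.\<close>

lemma no_contractible_edge_Delta_join: "\<not> contractible_edge (iterated_join k Delta_12_33) e"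
proof
  let ?D = "iterated_join k Delta_12_33"
  assume con: "contractible_edge ?D e"
  then have "e \<in> ?D" "card e = 2" by (auto simp: contractible_edge_def)
  then obtain p q where pq: "e = {p, q}" "p \<noteq> q" "{p, q} \<in> ?D" by (auto simp: card_2_iff)
  obtain i a j b where p: "p = (i, a)" and q: "q = (j, b)" by (metis surj_pair)
  have le: "i \<le> k" "j \<le> k" using pq(3) by (auto simp: edge_Delta_join p q)
  obtain c d where cd: "c \<in> set (nonneighbours a)" "d \<in> set (nonneighbours b)"
    and same: "i = j \<Longrightarrow> c \<notin> set (nonneighbours b) \<and> d \<notin> set (nonneighbours a) \<and>
      d \<notin> set (nonneighbours c)"
  proof (cases "i = j")
    case True
    then have "a \<noteq> b" "b \<notin> set (nonneighbours a)"
      using pq by (auto simp: edge_Delta_join p q)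
    then show thesis using edge_in_square in_all_vertices that by metis
  next
    case False
    have ne: "\<exists>w. w \<in> set (nonneighbours v)" for v
      by (cases v) auto
    obtain c d where "c \<in> set (nonneighbours a)" "d \<in> set (nonneighbours b)"
      using ne[of a] ne[of b] by metis
    then show thesis using that False by metis
  qed
  have "\<not> contractible_edge ?D {p, q}"
  proof (rule edge_in_square_not_contractible[of ?D p q "(i, c)" "(j, d)"])
    show "clique_complex ?D" by (rule clique_complex_iterated_join[OF clique_complex_Delta])
    show "{p, q} \<in> ?D" by (rule pq(3))
    show "{q, (i, c)} \<in> ?D" "{(i, c), (j, d)} \<in> ?D" "{(j, d), p} \<in> ?D"
      "{p, (i, c)} \<notin> ?D" "{q, (j, d)} \<notin> ?D"
      using le cd same nonneighbours_sym by (auto simp: edge_Delta_join p q)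
  qed
  then show False using con pq(1) by simp
qed

text \<open>Each vertex has at least two nonneighbours in its own copy.\<close>

lemma Delta_join_not_suspension: "\<not> is_suspension (iterated_join k Delta_12_33)"
proof (rule two_nonneighbours_not_suspension)
  let ?D = "iterated_join k Delta_12_33"
  fix p assume p: "p \<in> vertices ?D"
  obtain a b where ab: "a \<in> set (nonneighbours (snd p))" "b \<in> set (nonneighbours (snd p))" "a \<noteq> b"
    using nonneighbours_properties in_all_vertices[of "snd p"] card_2_iff'
    by (metis card_le_Suc0_iff_eq finite_set not_less_eq_eq numeral_2_eq_2)
  have "fst p \<le> k" using p by (auto simp: vertices_iterated_join[OF complex_Delta])
  moreover have "a \<noteq> snd p" "b \<noteq> snd p" using ab nonneighbours_irrefl by blast+
  ultimately show "\<exists>u\<in>vertices ?D. \<exists>w\<in>vertices ?D.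
      u \<noteq> w \<and> u \<noteq> p \<and> w \<noteq> p \<and> {p, u} \<notin> ?D \<and> {p, w} \<notin> ?D"
    using ab
    by (intro bexI[of _ "(fst p, a)"] bexI[of _ "(fst p, b)"])
      (auto simp: edge_Delta_join vertices_iterated_join[OF complex_Delta] vertices_Delta prod_eq_iff)
qed

lemma equator_Delta_join_is_link:
  assumes W: "W \<subseteq> vertices (iterated_join k Delta_12_33)"
    and sphere: "simplicial_sphere (4 * k + 2) (induced_subcomplex (iterated_join k Delta_12_33) W)"
  shows "\<exists>v\<in>vertices (iterated_join k Delta_12_33).
    induced_subcomplex (iterated_join k Delta_12_33) W = face_link (iterated_join k Delta_12_33) {v}"
proof -
  let ?D = "iterated_join k Delta_12_33"
  let ?E = "induced_subcomplex ?D W"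
  interpret complete_fan "4 * Suc k" ?D
      "\<lambda>p j. if j div 4 = fst p then real_coords (snd p) (j mod 4) else 0"
    by (rule complete_fan_iterated_join[OF complete_fan_Delta]) simp
  \<comment> \<open>The equator has dimension two below that of the space carrying the fan.\<close>
  have n: "4 * Suc k = Suc (Suc (4 * k + 2))" by simp
  have V: "vertices ?D = {..k} \<times> UNIV"
    by (simp add: vertices_iterated_join[OF complex_Delta] vertices_Delta)
  have clique: "clique_complex ?D" by (rule clique_complex_iterated_join[OF clique_complex_Delta])
  obtain U1 U2 where U: "U1 \<noteq> {}" "U2 \<noteq> {}" "U1 \<union> U2 = vertices ?D - W"
    and sep: "\<And>u1 u2. u1 \<in> U1 \<Longrightarrow> u2 \<in> U2 \<Longrightarrow> {u1, u2} \<notin> ?D"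
    by (rule complement_of_equator_disconnected[OF n sphere]) (rule that)
  have sep': "{u2, u1} \<notin> ?D" if "u1 \<in> U1" "u2 \<in> U2" for u1 u2
    using sep[OF that] by (simp add: insert_commute)
  have U': "U2 \<union> U1 = vertices ?D - W" using U(3) by blast
  \<comment> \<open>The roles of the two sides can be exchanged, so faces of the equator extend into
    each of them.\<close>
  have extend1: "\<exists>u\<in>U1. insert u F \<in> ?D" if "F \<in> ?E" "F \<noteq> {}" for F
    by (rule equator_face_extends_to_complement[OF n sphere U _ that]) (rule sep)
  have extend2: "\<exists>u\<in>U2. insert u F \<in> ?D" if "F \<in> ?E" "F \<noteq> {}" for F
    by (rule equator_face_extends_to_complement[OF n sphere U(2,1) U' _ that]) (rule sep')
  \<comment> \<open>When one side is a single vertex \<open>u\<close>, extension makes every vertex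
    of \<open>W\<close> adjacent to \<open>u\<close>, while the vertices of the other side are not;
    so \<open>W\<close> is the neighbourhood of \<open>u\<close>.\<close>
  have link: "?E = face_link ?D {u}"
    if un: "{u} \<union> U' = vertices ?D - W"
      and sep: "\<And>w. w \<in> U' \<Longrightarrow> {u, w} \<notin> ?D"
      and extend: "\<And>F. F \<in> ?E \<Longrightarrow> F \<noteq> {} \<Longrightarrow> insert u F \<in> ?D" for u U'
  proof (rule induced_neighbourhood_eq_link[OF clique _ W])
    show "u \<in> vertices ?D" using un by blast
    fix w assume w: "w \<in> vertices ?D"
    show "w \<in> W \<longleftrightarrow> w \<noteq> u \<and> {u, w} \<in> ?D"
    proof
      assume wW: "w \<in> W"
      then have "{w} \<in> ?E"
        using singleton_face[OF complex w] by (simp add: induced_subcomplex_def)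
      then have "{u, w} \<in> ?D" using extend by blast
      moreover have "u \<notin> W" using un by blast
      ultimately show "w \<noteq> u \<and> {u, w} \<in> ?D" using wW by blast
    next
      assume "w \<noteq> u \<and> {u, w} \<in> ?D"
      then have "w \<notin> {u} \<union> U'" using sep by blast
      then show "w \<in> W" using un w by blast
    qed
  qed
  consider u where "U1 = {u}" | u where "U2 = {u}"
    | p p' q q' where "p \<in> U1" "p' \<in> U1" "p \<noteq> p'" "q \<in> U2" "q' \<in> U2" "q \<noteq> q'"
    using U(1,2) by (metis insertI1 is_singletonI' is_singleton_def)
  then show ?thesis
  proof cases
    case (1 u)
    then have "?E = face_link ?D {u}"
      using U(3) sep extend1 by (intro link[of u U2]) auto
    then show ?thesis using 1 U(3) by blast
  next
    case (2 u)
    then have "?E = face_link ?D {u}"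
      using U' sep' extend2 by (intro link[of u U1]) auto
    then show ?thesis using 2 U(3) by blast
  next
    case (3 p p' q q')
    \<comment> \<open>Nonadjacent vertices of a join lie in the same copy. As every vertex of one
      side is nonadjacent to every vertex of the other, both sides lie in a single copy.\<close>
    have opposite: "fst u = fst w \<and> snd w \<in> set (nonneighbours (snd u))"
      if "u \<in> U1" "w \<in> U2" for u w
    proof -
      have "u \<in> vertices ?D" "w \<in> vertices ?D" using that U(3) by blast+
      then have "fst u \<le> k" "fst w \<le> k" by (auto simp: V)
      then show ?thesis using sep[OF that] by (simp add: edge_Delta_join)
    qed
    define i where "i = fst p"
    have copy2: "fst w = i" if "w \<in> U2" for w using opposite[OF 3(1) that] by (simp add: i_def)
    have copy1: "fst u = i" if "u \<in> U1" for u
      using opposite[OF that 3(4)] copy2[OF 3(4)] by simp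
    have "p \<in> vertices ?D" using 3(1) U(3) by blast
    then have ik: "i \<le> k" by (auto simp: i_def V)
    have "snd p \<noteq> snd p'" "snd q \<noteq> snd q'"
      using 3 copy1 copy2 by (auto simp: prod_eq_iff)
    moreover have "snd q \<in> set (nonneighbours (snd p))" "snd q' \<in> set (nonneighbours (snd p))"
      "snd p' \<in> set (nonneighbours (snd q))" "snd p' \<in> set (nonneighbours (snd q'))"
      using opposite 3 nonneighbours_sym by blast+
    ultimately obtain e where e: "e \<in> set facet_data"
      and avoid: "\<And>g. g \<in> facet e \<Longrightarrow>
        (g \<notin> set (nonneighbours (snd p)) \<or> g \<notin> set (nonneighbours (snd p'))) \<and>
        (g \<notin> set (nonneighbours (snd q)) \<or> g \<notin> set (nonneighbours (snd q')))"
      using facet_avoiding_biclique in_all_vertices by metis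
    \<comment> \<open>The avoiding facet, placed in copy \<open>i\<close> with all other layers
      empty, is a face inside \<open>W\<close>. Its extension by a vertex of \<open>U1\<close>,
      again in copy \<open>i\<close>, contradicts the maximality of the facet.\<close>
    let ?F = "Pair i ` facet e"
    have "Pair j -` ?F = (if j = i then facet e else {})" for j by auto
    moreover have "facet e \<in> Delta_12_33" using e by (auto simp: Delta_mem)
    ultimately have FD: "?F \<in> ?D"
      using ik empty_in_complex[OF complex_Delta] by (auto simp: mem_iterated_join[OF complex_Delta])
    have "(i, g) \<notin> U1 \<union> U2" if "g \<in> facet e" for g
      using avoid[OF that] opposite[of "(i, g)" q] opposite[of "(i, g)" q'] opposite[of p "(i, g)"]
        opposite[of p' "(i, g)"] nonneighbours_sym 3
      by auto
    then have "?F \<subseteq> W" using U(3) ik by (auto simp: V)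
    then have FE: "?F \<in> ?E" using FD by (simp add: induced_subcomplex_def)
    have maximal: "\<exists>g\<in>facet e. g \<in> set (nonneighbours c)" if "c \<notin> facet e" for c
      using facet_maximal_clique e that in_all_vertices by blast
    \<comment> \<open>An empty facet would have no vertex to serve as the nonneighbour that
      \<open>maximal\<close> provides.\<close>
    then have "facet e \<noteq> {}" by blast
    then obtain u where u: "u \<in> U1" "insert u ?F \<in> ?D" using extend1[OF FE] by blast
    have "u \<notin> ?F" using u(1) U(3) \<open>?F \<subseteq> W\<close> by blast
    then have "snd u \<notin> facet e" using copy1[OF u(1)] by (auto simp: image_iff prod_eq_iff)
    then obtain g where g: "g \<in> facet e" "g \<in> set (nonneighbours (snd u))" using maximal by blast
    have "{u, (i, g)} \<in> ?D" using face_pair[OF complex u(2)] g(1) by blast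
    then show ?thesis using g(2) copy1[OF u(1)] by (simp add: edge_Delta_join)
  qed
qed

theorem corollary4p2:
  fixes k :: nat and D :: "(nat \<times> vertex12) set set"
  defines "D \<equiv> iterated_join k Delta_12_33"
  shows "flag D \<and> simplicial_sphere (4 * k + 3) D \<and>
    \<not> (\<exists>e. contractible_edge D e) \<and>
    \<not> is_suspension D \<and>
    (\<forall>E. induced_equator (4 * k + 3) D E \<longrightarrow> (\<exists>v \<in> vertices D. E = face_link D {v}))"
proof (intro conjI allI impI)
  show "flag D"
    unfolding D_def by (rule flag_clique_complex[OF clique_complex_iterated_join[OF clique_complex_Delta]])
  \<comment> \<open>The fan lives in dimension \<open>4 * Suc k\<close>, one above that of the
    sphere.\<close>
  show "simplicial_sphere (4 * k + 3) D"
    unfolding D_def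
    by (rule complete_fan.simplicial_sphere_of_fan[OF complete_fan_iterated_join[OF complete_fan_Delta]])
      simp_all
  show "\<not> (\<exists>e. contractible_edge D e)"
    unfolding D_def using no_contractible_edge_Delta_join by blast
  show "\<not> is_suspension D"
    unfolding D_def by (rule Delta_join_not_suspension)
  fix E assume "induced_equator (4 * k + 3) D E"
  \<comment> \<open>Writing the dimension as a successor selects the branch of
    \<open>induced_equator\<close> for positive dimension.\<close>
  moreover have "4 * k + 3 = Suc (4 * k + 2)" by simp
  ultimately have "\<exists>W\<subseteq>vertices D. E = induced_subcomplex D W" "simplicial_sphere (4 * k + 2) E"
    unfolding induced_equator_def by (metis nat.case(2))+
  then show "\<exists>v\<in>vertices D. E = face_link D {v}"
    unfolding D_def using equator_Delta_join_is_link by blast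
qed

end
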